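(* Let $0<\alpha<1$, $x>0$ and $y\in C^\infty[0,x]$. For integers $n\ge 6$ put $h=x/n$, $y_j=y(jh)$ for $0\le j\le n$, and define $$\delta_0^{(\alpha)}=-\zeta(1+\alpha)+\tfrac32\zeta(\alpha)-\tfrac12\zeta(\alpha-1),\qquad \delta_1^{(\alpha)}=1-2\zeta(\alpha)+\zeta(\alpha-1),$$ $$\delta_2^{(\alpha)}=\frac{1}{2^{1+\alpha}}+\tfrac12\zeta(\alpha)-\tfrac12\zeta(\alpha-1),\qquad \delta_k^{(\alpha)}=\frac{1}{k^{1+\alpha}}\quad(3\le k\le n-3),$$ $$\delta_{n-2}^{(\alpha)}=\frac{1}{(n-2)^{1+\alpha}}-\frac12\left(n(n-1)S_n[\alpha+1]-(2n-1)S_n[\alpha]+S_n[\alpha-1]+\frac{(\alpha+2n-2)n^{1-\alpha}}{(\alpha-2)(\alpha-1)\alpha}\right),$$ $$\delta_{n-1}^{(\alpha)}=\frac{1}{(n-1)^{1+\alpha}}+n(n-2)S_n[\alpha+1]-2(n-1)S_n[\alpha]+S_n[\alpha-1]+\frac{2(\alpha+n-2)n^{1-\alpha}}{\alpha(1-\alpha)(2-\alpha)},$$ $$\delta_n^{(\alpha)}=-\frac12\left((n-1)(n-2)S_n[\alpha+1]-(2n-3)S_n[\alpha]+S_n[\alpha-1]+\frac{(3\alpha+2n-6)n^{1-\alpha}}{\alpha(1-\alpha)(2-\alpha)}\right).$$ Then, as $n\to\infty$ with $x$ fixed, $$\frac{1}{\Gamma(-\alpha)h^\alpha}\sum_{k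=0}^{n}\delta_k^{(\alpha)}y_{n-k}=y^{(\alpha)}(x)+O\left(h^{3-\alpha}\right).$$
   Context: $\zeta$ is the Riemann zeta function (analytically continued). $S_n[a]=\sum_{k=1}^{n-1}k^{-a}-\zeta(a)$. For $0<\alpha<1$ the Caputo derivative is $y^{(\alpha)}(x)=\frac{1}{\Gamma(1-\alpha)}\int_0^x\frac{y'(t)}{(x-t)^\alpha}\,dt$. The constant implied by $O(\cdot)$ may depend on $y,\alpha,x$ but not on $n$. *)

theory Defs
  imports "HOL-Analysis.Analysis" "HOL-Library.Landau_Symbols"
begin

(* The Riemann zeta function, as the analytic continuation of its Dirichlet series to the
   plane without 1. By the identity theorem the chosen function is unique except for its
   value at the pole 1, which is left unspecified. *)
definition zeta :: "complex \<Rightarrow> complex" where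
  "zeta = (SOME f. f holomorphic_on - {1} \<and>
             (\<forall>s. Re s > 1 \<longrightarrow> f s = (\<Sum>n. 1 / of_nat (Suc n) powr s)))"

definition zeta_real :: "real \<Rightarrow> real" where
  "zeta_real a = Re (zeta (of_real a))"

definition Szeta :: "nat \<Rightarrow> real \<Rightarrow> real" where
  "Szeta n a = (\<Sum>k=1..<n. real k powr (- a)) - zeta_real a"

(* Derivatives are taken within A, so they are one-sided at the endpoints of an interval. *)
definition smooth_on :: "real set \<Rightarrow> (real \<Rightarrow> real) \<Rightarrow> bool" where
  "smooth_on A y \<longleftrightarrow>
     (\<exists>D :: nat \<Rightarrow> real \<Rightarrow> real.
        (\<forall>t\<in>A. D 0 t = y t) \<and>
        (\<forall>k. \<forall>t\<in>A. (D k has_real_derivative D (Suc k) t) (at t within A)))"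

definition caputo :: "real \<Rightarrow> (real \<Rightarrow> real) \<Rightarrow> real \<Rightarrow> real" where
  "caputo \<alpha> y x =
     1 / Gamma (1 - \<alpha>) *
     integral {0..x} (\<lambda>t. vector_derivative y (at t within {0..x}) / (x - t) powr \<alpha>)"

(* Only meant for 6 \<le> n and k \<le> n, where the cases are mutually exclusive. *)
definition delta :: "real \<Rightarrow> nat \<Rightarrow> nat \<Rightarrow> real" where
  "delta \<alpha> n k =
    (let N = real n in
     if k = 0 then
       - zeta_real (1 + \<alpha>) + 3/2 * zeta_real \<alpha> - 1/2 * zeta_real (\<alpha> - 1)
     else if k = 1 then
       1 - 2 * zeta_real \<alpha> + zeta_real (\<alpha> - 1)
     else if k = 2 then
       1 / 2 powr (1 + \<alpha>) + 1/2 * zeta_real \<alpha> - 1/2 * zeta_real (\<alpha> - 1)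
     else if k + 3 \<le> n then
       1 / real k powr (1 + \<alpha>)
     else if k + 2 = n then
       1 / (N - 2) powr (1 + \<alpha>)
       - 1/2 * (N * (N - 1) * Szeta n (\<alpha> + 1) - (2 * N - 1) * Szeta n \<alpha> + Szeta n (\<alpha> - 1)
                + (\<alpha> + 2 * N - 2) * N powr (1 - \<alpha>) / ((\<alpha> - 2) * (\<alpha> - 1) * \<alpha>))
     else if k + 1 = n then
       1 / (N - 1) powr (1 + \<alpha>)
       + N * (N - 2) * Szeta n (\<alpha> + 1) - 2 * (N - 1) * Szeta n \<alpha> + Szeta n (\<alpha> - 1)
       + 2 * (\<alpha> + N - 2) * N powr (1 - \<alpha>) / (\<alpha> * (1 - \<alpha>) * (2 - \<alpha>))
     else
       - 1/2 * ((N - 1) * (N - 2) * Szeta n (\<alpha> + 1) - (2 * N - 3) * Szeta n \<alpha> + Szeta n (\<alpha> - 1)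
                + (3 * \<alpha> + 2 * N - 6) * N powr (1 - \<alpha>) / (\<alpha> * (1 - \<alpha>) * (2 - \<alpha>))))"

end

theory Submission
  imports Defs "HOL-Complex_Analysis.Complex_Analysis" "HOL-Real_Asymp.Real_Asymp"
begin

text \<open>
  With $z(t) = y(x - t)$ and $J = \int_0^x z'(t)\, t^{-\alpha}\, dt$ the Caputo derivative is
  $J / (\alpha\,\Gamma(-\alpha))$, so the claim is that
  $h^{-\alpha} \sum_k \delta_k z(kh) = J/\alpha + O(h^{3-\alpha})$.

  The weights $k^{-1-\alpha}$ give a Riemann sum of the Hadamard finite part of
  $\int_0^x z(t)\, t^{-1-\alpha}\, dt$, which is $J/\alpha$ up to a boundary term. Its error is
  governed by the two ends of the interval. At $t = 0$ the singular weight makes a Taylor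
  term $t^j$ contribute $\zeta(1 + \alpha - j)\, h^{j-\alpha}$; the weights $\delta_0, \delta_1,
  \delta_2$ cancel these for $j = 0, 1, 2$, with the derivatives of $z$ replaced by finite
  differences. At $t = x$ the last three weights are those that make the scheme exact for
  quadratic polynomials (\<open>sum_delta_quadratic\<close>).

  By this exactness the second-order Taylor polynomial of $z$ at $x$ may be subtracted, and one
  is left with a function $u$ that vanishes to third order at $x$. The end corrections meet only
  values of $u$ of size $O(h^3)$ and are themselves bounded (\<open>end_corr_bounded\<close>), so they
  contribute $O(h^{3-\alpha})$. Now write $u = p + r$ with $p$ the Taylor quadratic of $u$ at $0$.
  The sum over $r(t)\, t^{-1-\alpha}$ is handled by the trapezoidal rule with the $h^2/12$
  endpoint correction (\<open>singular_trapezoid\<close>). The sum over $p(t)\, t^{-1-\alpha}$ consists of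
  the partial sums $S_n[1 + \alpha - j]$, whose expansion (\<open>Szeta_asymp3\<close>) has the same
  boundary terms at $x$. Since $u(x) = u'(x) = 0$, the boundary terms of the two parts cancel
  (\<open>scheme_flat_end\<close>).

  The expansion of $S_n[a]$ needs $\zeta$ to the left of its pole. The continuation and the
  expansion come from the same recurrence, obtained by summing over $k \ge 1$ the Taylor expansion
  of $(k+1)^{1-s}$ around $k$: the left-hand side telescopes, the terms of the expansion are the
  series $\zeta(s), \zeta(s+1), \dots$, and the remainders decay faster the more terms are taken.
\<close>

section \<open>A recurrence for Dirichlet series\<close>

definition dirichlet_zeta :: "complex \<Rightarrow> complex" where
  "dirichlet_zeta s = (\<Sum>n. 1 / of_nat (Suc n) powr s)"

text \<open>The remainder of the Taylor expansion of $t^{1-s}$ of order \<open>M\<close>, at $t = k + 1$ around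
  $t = k$; its binomial series is what makes sums over \<open>k\<close> turn into zeta values.\<close>

definition powr_taylor_rem :: "nat \<Rightarrow> complex \<Rightarrow> nat \<Rightarrow> complex" where
  "powr_taylor_rem M s k = of_nat (Suc k) powr (1 - s)
     - (\<Sum>j\<le>M. ((1 - s) gchoose j) * of_nat k powr (1 - s - of_nat j))"

lemma of_nat_powr_Re:
  assumes "k \<ge> 1"
  shows "norm (of_nat k powr s :: complex) = real k powr Re s"
  using assms by (subst norm_powr_real_powr) auto

lemma gbinomial_Suc_mult:
  fixes a :: "'a :: field_char_0"
  shows "fact (Suc i) * (a gchoose Suc i) = fact i * (a gchoose i) * (a - of_nat i)"
  by (simp only: gbinomial_mult_fact prod.atLeast0_lessThan_Suc)

text \<open>Every further term gains a power of \<open>k\<close>, so the sum of the remainders converges on the half-plane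
  $\Re s > 1 - M$, on which it will be holomorphic: this is what moves the abscissa to the left.\<close>

lemma powr_taylor_rem_bound:
  assumes k: "k \<ge> 1" and s: "Re s \<ge> - real M"
  shows "norm (powr_taylor_rem M s k)
           \<le> norm ((1 - s) gchoose Suc M) * real (Suc M) * real k powr (- Re s - real M)"
proof -
  define S :: "complex set" where "S = closed_segment (of_nat k) (of_nat (Suc k))"
  define f :: "nat \<Rightarrow> complex \<Rightarrow> complex" where
    "f = (\<lambda>i t. fact i * ((1 - s) gchoose i) * t powr (1 - s - of_nat i))"
  have S: "Re t \<ge> real k \<and> t = of_real (Re t)" if t: "t \<in> S" for t
  proof -
    from t obtain u where u: "0 \<le> u" "u \<le> 1"
      and t': "t = (1 - u) *\<^sub>R of_nat k + u *\<^sub>R of_nat (Suc k)"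
      unfolding S_def closed_segment_def by auto
    have "t = of_real (real k + u)" by (simp add: t' scaleR_conv_of_real algebra_simps)
    with u show ?thesis by auto
  qed
  define B where "B = norm ((1 - s) gchoose Suc M) * fact (Suc M) * real k powr (- Re s - real M)"
  have "norm (f 0 (of_nat (Suc k)) -
          (\<Sum>i\<le>M. f i (of_nat k) * (of_nat (Suc k) - of_nat k) ^ i / (fact i)))
        \<le> B * norm (of_nat (Suc k) - of_nat k :: complex) ^ (Suc M) / fact M"
  proof (rule field_Taylor)
    show "convex S" by (simp add: S_def)
    show "of_nat k \<in> S" "of_nat (Suc k) \<in> S" by (auto simp: S_def)
    show "norm (f (Suc M) t) \<le> B" if t: "t \<in> S" for t
    proof -
      have r: "Re t > 0" using S[OF t] k by linarith
      have "norm (t powr (1 - s - of_nat (Suc M))) = Re t powr (- Re s - real M)"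
        using S[OF t] r by (subst norm_powr_real_powr) (auto simp: complex_is_Real_iff, metis Im_complex_of_real)
      also have "\<dots> \<le> real k powr (- Re s - real M)"
        using S[OF t] r k s by (intro powr_mono2') auto
      finally show ?thesis
        unfolding f_def B_def norm_mult
        by (simp add: mult_left_mono mult_ac del: of_nat_Suc fact_Suc)
    qed
    show "(f i has_field_derivative f (Suc i) t) (at t within S)" if t: "t \<in> S" for i t
    proof -
      have "t \<notin> \<real>\<^sub>\<le>\<^sub>0" using S[OF t] k by (auto simp: complex_nonpos_Reals_iff)
      then have "((\<lambda>t. t powr (1 - s - of_nat i)) has_field_derivative
          (1 - s - of_nat i) * t powr (1 - s - of_nat i - 1)) (at t)"
        by (rule has_field_derivative_powr)
      then have "(f i has_field_derivative
          fact i * ((1 - s) gchoose i) * ((1 - s - of_nat i) * t powr (1 - s - of_nat i - 1))) (at t)"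
        unfolding f_def by (rule DERIV_cmult)
      also have "fact i * ((1 - s) gchoose i) * ((1 - s - of_nat i) * t powr (1 - s - of_nat i - 1))
          = f (Suc i) t"
        unfolding f_def gbinomial_Suc_mult by (simp add: algebra_simps)
      finally show ?thesis by (rule has_field_derivative_at_within)
    qed
  qed
  moreover have "f 0 (of_nat (Suc k)) -
          (\<Sum>i\<le>M. f i (of_nat k) * (of_nat (Suc k) - of_nat k) ^ i / (fact i)) = powr_taylor_rem M s k"
    unfolding powr_taylor_rem_def f_def by simp
  moreover have "B * norm (of_nat (Suc k) - of_nat k :: complex) ^ (Suc M) / fact M
     = norm ((1 - s) gchoose Suc M) * real (Suc M) * real k powr (- Re s - real M)"
    by (simp add: B_def field_simps)
  ultimately show ?thesis by simp
qed

lemma summable_powr_Suc: "b > 1 \<Longrightarrow> summable (\<lambda>k. real (Suc k) powr (- b))"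
  by (subst summable_Suc_iff) (simp add: summable_real_powr_iff)

lemma summable_powr_taylor_rem:
  assumes "Re s > 1 - real M"
  shows "summable (\<lambda>k. powr_taylor_rem M s (Suc k))"
proof (rule summable_comparison_test')
  show "summable (\<lambda>k. norm ((1 - s) gchoose Suc M) * real (Suc M) * real (Suc k) powr (- (Re s + real M)))"
    using assms by (intro summable_mult summable_powr_Suc) auto
  show "norm (powr_taylor_rem M s (Suc k))
     \<le> norm ((1 - s) gchoose Suc M) * real (Suc M) * real (Suc k) powr (- (Re s + real M))" for k
    using powr_taylor_rem_bound[of "Suc k" M s] assms by (simp add: algebra_simps)
qed

lemma sum_powr_taylor_rem:
  "(\<Sum>k<N. powr_taylor_rem M s (Suc k)) = of_nat (Suc N) powr (1 - s) - 1
     - (\<Sum>j=1..M. ((1 - s) gchoose j) * (\<Sum>k<N. of_nat (Suc k) powr (1 - s - of_nat j)))"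
proof (induction N)
  case (Suc N)
  have "{..M} = insert 0 {1..M}" by auto
  then have "powr_taylor_rem M s (Suc N) = of_nat (Suc (Suc N)) powr (1 - s) - of_nat (Suc N) powr (1 - s)
     - (\<Sum>j=1..M. ((1 - s) gchoose j) * of_nat (Suc N) powr (1 - s - of_nat j))"
    unfolding powr_taylor_rem_def by (simp del: of_nat_Suc)
  with Suc show ?case
    by (simp add: distrib_left sum.distrib del: of_nat_Suc)
qed (simp)

text \<open>On a compact disc inside the half-plane the exponent stays bounded away from $-1$ and \<open>c\<close> stays
  bounded, so the M-test gives locally uniform convergence.\<close>

lemma holomorphic_suminf_halfplane:
  fixes f :: "nat \<Rightarrow> complex \<Rightarrow> complex" and c :: "complex \<Rightarrow> real"
  assumes hol: "\<And>k. f k holomorphic_on UNIV"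
    and cont: "continuous_on UNIV c"
    and bd: "\<And>k s. Re s > 1 - b \<Longrightarrow> norm (f k s) \<le> c s * real (Suc k) powr (- (Re s + b))"
  shows "(\<lambda>s. \<Sum>k. f k s) holomorphic_on {s. Re s > 1 - b}"
proof (rule holomorphic_uniform_sequence)
  show o: "open {s. Re s > 1 - b}" by (rule open_halfspace_Re_gt)
  show "(\<lambda>s. \<Sum>k<n. f k s) holomorphic_on {s. Re s > 1 - b}" for n
    using hol by (intro holomorphic_on_sum) (meson holomorphic_on_subset subset_UNIV)
  fix s assume s: "s \<in> {s. Re s > 1 - b}"
  (* half the distance of s to the boundary line *)
  define d where "d = (Re s + b - 1) / 2"
  have d: "d > 0" using s by (simp add: d_def)
  have Re: "Re z + b \<ge> 1 + d" if "z \<in> cball s d" for z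
  proof -
    have "\<bar>Re s - Re z\<bar> \<le> norm (s - z)" using abs_Re_le_cmod[of "s - z"] by simp
    with that have "Re s - Re z \<le> d" by (simp add: dist_norm)
    then show ?thesis unfolding d_def by (simp add: field_simps)
  qed
  obtain C where C: "\<And>z. z \<in> cball s d \<Longrightarrow> norm (c z) \<le> C"
    using compact_continuous_image[OF continuous_on_subset[OF cont] compact_cball, of s d]
    by (metis bounded_iff compact_imp_bounded imageI subset_UNIV)
  have "uniform_limit (cball s d) (\<lambda>n z. \<Sum>k<n. f k z) (\<lambda>z. \<Sum>k. f k z) sequentially"
  proof (rule Weierstrass_m_test)
    show "summable (\<lambda>k. C * real (Suc k) powr (- (1 + d)))"
      using d by (intro summable_mult summable_powr_Suc) auto
    fix k z assume z: "z \<in> cball s d"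
    have "norm (f k z) \<le> c z * real (Suc k) powr (- (Re z + b))"
      using Re[OF z] d by (intro bd) auto
    also have "\<dots> \<le> C * real (Suc k) powr (- (1 + d))"
      using C[OF z] Re[OF z] d
      by (intro mult_mono powr_mono) auto
    finally show "norm (f k z) \<le> C * real (Suc k) powr (- (1 + d))" .
  qed
  moreover have "cball s d \<subseteq> {s. Re s > 1 - b}" using Re d by fastforce
  ultimately show "\<exists>d>0. cball s d \<subseteq> {s. Re s > 1 - b} \<and>
      uniform_limit (cball s d) (\<lambda>n z. \<Sum>k<n. f k z) (\<lambda>z. \<Sum>k. f k z) sequentially"
    using d by blast
qed

lemma holomorphic_gbinomial: "(\<lambda>s. (1 - s) gchoose j) holomorphic_on (A :: complex set)"
  unfolding gbinomial_prod_rev divide_complex_def[symmetric] by (auto intro!: holomorphic_intros)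

lemma holomorphic_sum_powr_taylor_rem:
  "(\<lambda>s. \<Sum>k. powr_taylor_rem M s (Suc k)) holomorphic_on {s. Re s > 1 - real M}"
proof (rule holomorphic_suminf_halfplane)
  show "(\<lambda>s. powr_taylor_rem M s (Suc k)) holomorphic_on UNIV" for k
    unfolding powr_taylor_rem_def
    by (auto intro!: holomorphic_intros holomorphic_gbinomial simp del: of_nat_Suc)
  show "continuous_on UNIV (\<lambda>s :: complex. norm ((1 - s) gchoose Suc M) * real (Suc M))"
    by (intro continuous_intros holomorphic_on_imp_continuous_on[OF holomorphic_gbinomial])
  show "norm (powr_taylor_rem M s (Suc k)) \<le>
         norm ((1 - s) gchoose Suc M) * real (Suc M) * real (Suc k) powr - (Re s + real M)"
    if "Re s > 1 - real M" for s k
    using powr_taylor_rem_bound[of "Suc k" M s] that by (simp add: algebra_simps)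
qed

lemma dirichlet_zeta_sums:
  assumes "Re s > 1"
  shows "(\<lambda>k. of_nat (Suc k) powr (- s)) sums dirichlet_zeta s"
proof -
  have "summable (\<lambda>k. of_nat (Suc k) powr (- s) :: complex)"
  proof (rule summable_comparison_test')
    show "summable (\<lambda>k. real (Suc k) powr (- Re s))" using assms by (intro summable_powr_Suc)
    show "norm (of_nat (Suc k) powr (- s) :: complex) \<le> real (Suc k) powr (- Re s)" for k
      by (subst of_nat_powr_Re) auto
  qed
  then show ?thesis
    unfolding dirichlet_zeta_def by (simp add: powr_minus_divide sums_iff)
qed

lemma holomorphic_dirichlet_zeta: "dirichlet_zeta holomorphic_on {s. Re s > 1}"
proof -
  have "(\<lambda>s. \<Sum>k. of_nat (Suc k) powr (- s)) holomorphic_on {s. Re s > 1 - 0}"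
    by (rule holomorphic_suminf_halfplane[where c = "\<lambda>_. 1"])
      (auto intro!: holomorphic_intros simp: of_nat_powr_Re simp del: of_nat_Suc)
  then show ?thesis
    using dirichlet_zeta_sums[THEN sums_unique] by (subst holomorphic_cong[OF refl]) auto
qed

text \<open>The limit of the telescoping identity \<open>sum_powr_taylor_rem\<close>.\<close>

lemma dirichlet_zeta_recurrence:
  assumes M: "M \<ge> 1" and s: "Re s > 1"
  shows "(\<Sum>j=1..M. ((1 - s) gchoose j) * dirichlet_zeta (s + of_nat j - 1))
           + (\<Sum>k. powr_taylor_rem M s (Suc k)) = -1"
proof -
  have "(\<lambda>N. \<Sum>k<N. powr_taylor_rem M s (Suc k)) \<longlonglongrightarrow> (\<Sum>k. powr_taylor_rem M s (Suc k))"
    by (intro summable_LIMSEQ summable_powr_taylor_rem) (use M s in auto)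
  moreover have "(\<lambda>N. of_nat (Suc N) powr (1 - s) - 1
     - (\<Sum>j=1..M. ((1 - s) gchoose j) * (\<Sum>k<N. of_nat (Suc k) powr (1 - s - of_nat j))))
     \<longlonglongrightarrow> 0 - 1 - (\<Sum>j=1..M. ((1 - s) gchoose j) * dirichlet_zeta (s + of_nat j - 1))"
  proof (intro tendsto_intros)
    have "(\<lambda>N. real (Suc N) powr (1 - Re s)) \<longlonglongrightarrow> 0"
      using s by real_asymp
    then show "(\<lambda>N. of_nat (Suc N) powr (1 - s) :: complex) \<longlonglongrightarrow> 0"
      by (subst tendsto_norm_zero_iff[symmetric]) (simp add: of_nat_powr_Re del: of_nat_Suc)
    fix j assume "j \<in> {1..M}"
    then have "(\<lambda>k. of_nat (Suc k) powr (- (s + of_nat j - 1))) sums dirichlet_zeta (s + of_nat j - 1)"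
      using s by (intro dirichlet_zeta_sums) auto
    then show "(\<lambda>N. \<Sum>k<N. of_nat (Suc k) powr (1 - s - of_nat j)) \<longlonglongrightarrow> dirichlet_zeta (s + of_nat j - 1)"
      by (simp add: sums_def algebra_simps)
  qed
  ultimately have "(\<Sum>k. powr_taylor_rem M s (Suc k))
      = 0 - 1 - (\<Sum>j=1..M. ((1 - s) gchoose j) * dirichlet_zeta (s + of_nat j - 1))"
    unfolding sum_powr_taylor_rem using LIMSEQ_unique by blast
  then show ?thesis by simp
qed

section \<open>Analytic continuation of the zeta function\<close>

lemma gbinomial_Suc_step:
  fixes a :: "'a :: field_char_0"
  shows "a gchoose Suc i = (a gchoose i) / of_nat (Suc i) * (a - of_nat i)"
proof -
  have "fact i * (of_nat (Suc i) * (a gchoose Suc i)) = fact i * ((a gchoose i) * (a - of_nat i))"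
    using gbinomial_Suc_mult[of i a] by (simp add: mult_ac)
  then have "of_nat (Suc i) * (a gchoose Suc i) = (a gchoose i) * (a - of_nat i)"
    by (subst (asm) mult_left_cancel) auto
  then show ?thesis
    by (simp add: field_simps del: of_nat_Suc)
qed

text \<open>On the half-plane $\Re s > 1 - m$ this is $(s - 1)\,\zeta(s)$; each step uses the recurrence to move
  the boundary by one to the left. Multiplying by $s - 1$ removes the pole; in the recurrence the factor
  ${1-s \choose i+1}$ then contains exactly the denominator $s + i - 1$ of $\zeta(s+i)$, so that
  only polynomial coefficients remain and no exceptional points arise.\<close>

primrec zeta_step :: "nat \<Rightarrow> complex \<Rightarrow> complex" where
  "zeta_step 0 = (\<lambda>s. (s - 1) * dirichlet_zeta s)"
| "zeta_step (Suc m) = (\<lambda>s. 1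
      - (\<Sum>i=1..m. ((1 - s) gchoose i) / of_nat (Suc i) * zeta_step m (s + of_nat i))
      + (\<Sum>k. powr_taylor_rem (Suc m) s (Suc k)))"

text \<open>Rewrites the recurrence for $Z$ in terms of $W(s) = (s - 1) Z(s)$, using
  ${1-s \choose i+1} = -{1-s \choose i}\,\frac{s+i-1}{i+1}$.\<close>

lemma recurrence_shift:
  fixes Z W :: "complex \<Rightarrow> complex"
  assumes "\<And>i. i \<in> {1..m} \<Longrightarrow> W (s + of_nat i) = (s + of_nat i - 1) * Z (s + of_nat i)"
  shows "(\<Sum>j=1..Suc m. ((1 - s) gchoose j) * Z (s + of_nat j - 1))
    = (1 - s) * Z s - (\<Sum>i=1..m. ((1 - s) gchoose i) / of_nat (Suc i) * W (s + of_nat i))"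
proof -
  have "(\<Sum>j=1..Suc m. ((1 - s) gchoose j) * Z (s + of_nat j - 1))
      = (1 - s) * Z s + (\<Sum>j=Suc 1..Suc m. ((1 - s) gchoose j) * Z (s + of_nat j - 1))"
    by (subst sum.atLeast_Suc_atMost) auto
  also have "(\<Sum>j=Suc 1..Suc m. ((1 - s) gchoose j) * Z (s + of_nat j - 1))
      = (\<Sum>i=1..m. ((1 - s) gchoose Suc i) * Z (s + of_nat i))"
    by (subst sum.shift_bounds_cl_Suc_ivl) simp
  also have "\<dots> = (\<Sum>i=1..m. - (((1 - s) gchoose i) / of_nat (Suc i) * W (s + of_nat i)))"
  proof (rule sum.cong[OF refl])
    fix i assume i: "i \<in> {1..m}"
    have neg: "1 - s - of_nat i = - (s + of_nat i - 1)" by simp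
    show "((1 - s) gchoose Suc i) * Z (s + of_nat i)
      = - (((1 - s) gchoose i) / of_nat (Suc i) * W (s + of_nat i))"
      unfolding gbinomial_Suc_step assms[OF i] neg
      by (simp only: mult_minus_left mult_minus_right mult.assoc)
  qed
  finally show ?thesis by (simp add: sum_negf)
qed

lemma zeta_step_dirichlet:
  assumes "Re s > 1"
  shows "zeta_step m s = (s - 1) * dirichlet_zeta s"
  using assms
proof (induction m arbitrary: s)
  case (Suc m)
  have "(\<Sum>j=1..Suc m. ((1 - s) gchoose j) * dirichlet_zeta (s + of_nat j - 1))
    = (1 - s) * dirichlet_zeta s
        - (\<Sum>i=1..m. ((1 - s) gchoose i) / of_nat (Suc i) * zeta_step m (s + of_nat i))"
    by (rule recurrence_shift) (use Suc in auto)
  moreover have "(\<Sum>j=1..Suc m. ((1 - s) gchoose j) * dirichlet_zeta (s + of_nat j - 1))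
      + (\<Sum>k. powr_taylor_rem (Suc m) s (Suc k)) = -1"
    by (rule dirichlet_zeta_recurrence) (use Suc.prems in auto)
  moreover have "1 - B + R = (s - 1) * D" if "A = (1 - s) * D - B" "A + R = -1" for A B D R :: complex
    using that by algebra
  ultimately show ?case
    unfolding zeta_step.simps by blast
qed simp

lemma holomorphic_zeta_step: "zeta_step m holomorphic_on {s. Re s > 1 - real m}"
proof (induction m)
  case 0
  show ?case using holomorphic_dirichlet_zeta by (auto intro!: holomorphic_intros)
next
  case (Suc m)
  have "(\<lambda>s. zeta_step m (s + of_nat i)) holomorphic_on {s. Re s > 1 - real (Suc m)}"
    if "i \<in> {1..m}" for i
    using holomorphic_on_compose_gen[OF _ Suc,
        of "\<lambda>s. s + of_nat i" "{s. Re s > 1 - real (Suc m)}"] that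
    by (force simp: o_def intro!: holomorphic_intros)
  then show ?case
    using holomorphic_sum_powr_taylor_rem[of "Suc m"]
    by (auto intro!: holomorphic_intros holomorphic_gbinomial simp del: of_nat_Suc)
qed

lemma zeta_step_agree:
  assumes "m \<le> m'" and "Re s > 1 - real m"
  shows "zeta_step m s = zeta_step m' s"
proof (rule analytic_continuation_open[of "{s. Re s > 1}" "{s. Re s > 1 - real m}"
      "zeta_step m" "zeta_step m'"])
  show "open {s. Re s > 1}" "open {s. Re s > 1 - real m}" by (rule open_halfspace_Re_gt)+
  have "2 \<in> {s. Re s > 1}" by simp
  then show "{s. Re s > 1} \<noteq> {}" by blast
  show "connected {s. Re s > 1 - real m}"
    by (intro convex_connected convex_halfspace_Re_gt)
  show "zeta_step m holomorphic_on {s. Re s > 1 - real m}" by (rule holomorphic_zeta_step)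
  show "zeta_step m' holomorphic_on {s. Re s > 1 - real m}"
    by (rule holomorphic_on_subset[OF holomorphic_zeta_step]) (use assms in auto)
qed (use assms in \<open>auto simp: zeta_step_dirichlet\<close>)

text \<open>The functions \<open>zeta_step m\<close> agree where two of them are defined and so glue to an entire function,
  which is divided by $s - 1$. This makes the choice in the definition of \<open>zeta\<close> legitimate.\<close>

lemma zeta_exists:
  "\<exists>f. f holomorphic_on - {1} \<and> (\<forall>s. Re s > 1 \<longrightarrow> f s = dirichlet_zeta s)"
proof -
  (* any choice of m with Re s > 1 - m would do *)
  define W where "W = (\<lambda>s. zeta_step (nat \<lceil>2 - Re s\<rceil>) s)"
  have W: "W s = zeta_step m s" if "Re s > 1 - real m" for m s
  proof -
    have "Re s > 1 - real (nat \<lceil>2 - Re s\<rceil>)" by linarith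
    with that show ?thesis
      unfolding W_def using zeta_step_agree[of m "nat \<lceil>2 - Re s\<rceil>" s]
        zeta_step_agree[of "nat \<lceil>2 - Re s\<rceil>" m s] by (metis nle_le)
  qed
  have "W holomorphic_on (\<Union>m. {s. Re s > 1 - real m})"
  proof (rule holomorphic_on_UN_open)
    show "W holomorphic_on {s. Re s > 1 - real m}" for m
      by (subst holomorphic_cong[OF refl W]) (auto intro: holomorphic_zeta_step)
  qed (auto intro: open_halfspace_Re_gt)
  also have "(\<Union>m. {s. Re s > 1 - real m}) = UNIV"
  proof -
    have "\<exists>m. Re s > 1 - real m" for s
      using reals_Archimedean2[of "1 - Re s"] by (metis diff_less_eq add.commute)
    then show ?thesis by auto
  qed
  finally have "W holomorphic_on UNIV" .
  then have "(\<lambda>s. W s / (s - 1)) holomorphic_on - {1}"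
    by (auto intro!: holomorphic_intros elim: holomorphic_on_subset)
  moreover have "W s / (s - 1) = dirichlet_zeta s" if "Re s > 1" for s
  proof -
    have "s \<noteq> 1" using that by auto
    with W[of 0 s] that show ?thesis by simp
  qed
  ultimately show ?thesis by blast
qed

lemma
  shows holomorphic_zeta: "zeta holomorphic_on - {1}"
    and zeta_dirichlet: "Re s > 1 \<Longrightarrow> zeta s = dirichlet_zeta s"
  using someI_ex[OF zeta_exists] unfolding zeta_def dirichlet_zeta_def by blast+

lemma zeta_step_eq:
  assumes "s \<noteq> 1" and "Re s > 1 - real m"
  shows "zeta_step m s = (s - 1) * zeta s"
proof (rule analytic_continuation_open[of "{s. Re s > 1}" "{s. Re s > 1 - real m} - {1}"
      "zeta_step m" "\<lambda>s. (s - 1) * zeta s"])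
  show "open {s. Re s > 1}" "open ({s. Re s > 1 - real m} - {1})"
    by (auto intro!: open_halfspace_Re_gt)
  have "2 \<in> {s. Re s > 1}" by simp
  then show "{s. Re s > 1} \<noteq> {}" by blast
  show "connected ({s. Re s > 1 - real m} - {1})"
    by (intro connected_open_delete convex_connected convex_halfspace_Re_gt open_halfspace_Re_gt) auto
  show "zeta_step m holomorphic_on {s. Re s > 1 - real m} - {1}"
    by (rule holomorphic_on_subset[OF holomorphic_zeta_step]) auto
  show "(\<lambda>s. (s - 1) * zeta s) holomorphic_on {s. Re s > 1 - real m} - {1}"
    by (intro holomorphic_intros holomorphic_on_subset[OF holomorphic_zeta]) auto
qed (use assms in \<open>auto simp: zeta_step_dirichlet zeta_dirichlet\<close>)

text \<open>At the excluded points one of the zeta values is the unspecified value at the pole.\<close>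

lemma zeta_recurrence:
  assumes M: "M \<ge> 1" and s: "Re s > 1 - real M" and pole: "\<And>j. j < M \<Longrightarrow> s + of_nat j \<noteq> 1"
  shows "(\<Sum>j=1..M. ((1 - s) gchoose j) * zeta (s + of_nat j - 1))
           + (\<Sum>k. powr_taylor_rem M s (Suc k)) = -1"
proof -
  obtain m where m: "M = Suc m" using M by (cases M) auto
  have "(\<Sum>j=1..Suc m. ((1 - s) gchoose j) * zeta (s + of_nat j - 1))
    = (1 - s) * zeta s
        - (\<Sum>i=1..m. ((1 - s) gchoose i) / of_nat (Suc i) * zeta_step m (s + of_nat i))"
    by (rule recurrence_shift) (use s pole m in \<open>auto simp: zeta_step_eq\<close>)
  moreover have "zeta_step M s = (s - 1) * zeta s"
    by (rule zeta_step_eq) (use pole[of 0] m s in auto)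
  moreover have cancel: "A + R = -1" if "A = (1 - s) * D - B" "1 - B + R = (s - 1) * D"
    for A B D R :: complex
    using that by algebra
  ultimately show ?thesis
    unfolding m zeta_step.simps using cancel by blast
qed

section \<open>Asymptotics of the partial sums of zeta\<close>

lemma powr_le_telescope:
  fixes x b :: real
  assumes b: "b > 1" and x: "x \<ge> 1"
  shows "x powr (- b) \<le> 2 powr b / (b - 1) * (x powr (1 - b) - (x + 1) powr (1 - b))"
proof -
  have "\<exists>z. x < z \<and> z < x + 1 \<and>
      (x + 1) powr (1 - b) - x powr (1 - b) = (x + 1 - x) * ((1 - b) * z powr (1 - b - 1))"
    by (rule MVT2[of x "x + 1" "\<lambda>z. z powr (1 - b)" "\<lambda>z. (1 - b) * z powr (1 - b - 1)"]) (use x in \<open>auto intro!: derivative_eq_intros\<close>)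
  then obtain z where z: "x < z" "z < x + 1"
    and eq: "x powr (1 - b) - (x + 1) powr (1 - b) = (b - 1) * z powr (- b)"
    by (auto simp: algebra_simps)
  have "x powr (- b) = 2 powr b * (2 * x) powr (- b)"
    using x by (simp add: powr_mult powr_minus field_simps)
  also have "\<dots> \<le> 2 powr b * z powr (- b)"
    using x z b by (intro mult_left_mono powr_mono2') auto
  also have "\<dots> = 2 powr b / (b - 1) * (x powr (1 - b) - (x + 1) powr (1 - b))"
    unfolding eq using b by simp
  finally show ?thesis .
qed

lemma suminf_powr_tail_le:
  assumes b: "b > 1"
  shows "summable (\<lambda>k. real (Suc (k + N)) powr (- b))"
    and "(\<Sum>k. real (Suc (k + N)) powr (- b)) \<le> 2 powr b / (b - 1) * real (Suc N) powr (1 - b)"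
proof -
  define F where "F = (\<lambda>k. real (Suc (k + N)) powr (1 - b))"
  show sm: "summable (\<lambda>k. real (Suc (k + N)) powr (- b))"
    using summable_ignore_initial_segment[OF summable_powr_Suc[OF b], of N] by simp
  have "F \<longlonglongrightarrow> 0" unfolding F_def using b by real_asymp
  then have "(\<lambda>k. F k - F (Suc k)) sums (F 0 - 0)" by (rule telescope_sums')
  then have *: "(\<lambda>k. 2 powr b / (b - 1) * (F k - F (Suc k))) sums (2 powr b / (b - 1) * (F 0 - 0))"
    by (rule sums_mult)
  have "(\<Sum>k. real (Suc (k + N)) powr (- b)) \<le> (\<Sum>k. 2 powr b / (b - 1) * (F k - F (Suc k)))"
  proof (rule suminf_le)
    show "real (Suc (k + N)) powr (- b) \<le> 2 powr b / (b - 1) * (F k - F (Suc k))" for k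
      using powr_le_telescope[OF b, of "real (Suc (k + N))"] by (simp add: F_def add_ac)
  qed (use sm * in \<open>auto simp: sums_iff\<close>)
  also have "\<dots> = 2 powr b / (b - 1) * real (Suc N) powr (1 - b)"
    using * by (simp add: sums_iff F_def)
  finally show "(\<Sum>k. real (Suc (k + N)) powr (- b)) \<le> \<dots>" .
qed

lemma gbinomial_of_real:
  "(of_real a :: complex) gchoose j = of_real (a gchoose j)"
  by (simp add: gbinomial_prod_rev)

text \<open>The finite sums up to \<open>n - 1\<close> satisfy the recurrence with $n^{1-a} - 1$ in place of $-1$ and the
  first remainders only. Subtracting the recurrence of zeta leaves the tail of the remainders as the error.\<close>

lemma Szeta_recurrence:
  assumes M: "M \<ge> 1" and a: "a > 1 - real M" and pole: "\<And>j. j < M \<Longrightarrow> a + real j \<noteq> 1"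
  shows "(\<lambda>n. (\<Sum>j=1..M. ((1 - a) gchoose j) * Szeta n (a + real j - 1)) - real n powr (1 - a))
           \<in> O(\<lambda>n. real n powr (1 - a - real M))"
proof -
  define s where "s = complex_of_real a"
  define R where "R = (\<lambda>k. powr_taylor_rem M s (Suc k))"
  define K where "K = norm ((1 - s) gchoose Suc M) * real (Suc M)"
  define b where "b = a + real M"
  have b: "b > 1" using a by (simp add: b_def)
  have Rsum: "summable R" unfolding R_def
    by (rule summable_powr_taylor_rem) (use a in \<open>simp add: s_def\<close>)
  have rec: "(\<Sum>j=1..M. ((1 - s) gchoose j) * zeta (s + of_nat j - 1)) + (\<Sum>k. R k) = -1"
    unfolding R_def
  proof (rule zeta_recurrence)
    fix j assume "j < M"
    then have "complex_of_real (a + real j) \<noteq> 1" using pole of_real_eq_1_iff by blast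
    then show "s + of_nat j \<noteq> 1" by (simp add: s_def)
  qed (use M a in \<open>simp_all add: s_def\<close>)
  have bin: "(1 - s) gchoose j = of_real ((1 - a) gchoose j)" for j
    using gbinomial_of_real[of "1 - a" j] by (simp add: s_def)
  have bd: "\<bar>(\<Sum>j=1..M. ((1 - a) gchoose j) * Szeta (Suc N) (a + real j - 1)) - real (Suc N) powr (1 - a)\<bar>
      \<le> K * (2 powr b / (b - 1)) * real (Suc N) powr (1 - b)" for N
  proof -
    have Sz: "Szeta (Suc N) (a + real j - 1)
       = Re ((\<Sum>k<N. of_nat (Suc k) powr (1 - s - of_nat j)) - zeta (s + of_nat j - 1))" for j
    proof -
      have "of_nat (Suc k) powr (1 - s - of_nat j) = of_real (real (Suc k) powr (- (a + real j - 1)))" for k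
        unfolding s_def by (subst powr_of_real[symmetric]) (auto simp: diff_diff_eq)
      moreover have "{1..<Suc N} = Suc ` {..<N}" by (auto simp: image_iff) (metis Suc_le_D Suc_le_lessD lessThan_iff less_Suc_eq_le)
      moreover have "of_real (a + real j - 1) = s + of_nat j - 1"
        by (simp add: s_def)
      ultimately show ?thesis
        unfolding Szeta_def zeta_real_def by (simp add: sum.reindex)
    qed
    have "(\<Sum>j=1..M. ((1 - a) gchoose j) * Szeta (Suc N) (a + real j - 1))
        = Re (\<Sum>j=1..M. ((1 - s) gchoose j) * ((\<Sum>k<N. of_nat (Suc k) powr (1 - s - of_nat j)) - zeta (s + of_nat j - 1)))"
      unfolding Sz bin by simp
    also have "(\<Sum>j=1..M. ((1 - s) gchoose j) * ((\<Sum>k<N. of_nat (Suc k) powr (1 - s - of_nat j)) - zeta (s + of_nat j - 1)))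
       = (\<Sum>j=1..M. ((1 - s) gchoose j) * (\<Sum>k<N. of_nat (Suc k) powr (1 - s - of_nat j)))
         - (\<Sum>j=1..M. ((1 - s) gchoose j) * zeta (s + of_nat j - 1))"
      by (simp add: right_diff_distrib sum_subtractf)
    also have "\<dots> = of_nat (Suc N) powr (1 - s) + (\<Sum>k. R (k + N))"
    proof -
      have "(\<Sum>k. R k) = (\<Sum>k. R (k + N)) + (\<Sum>k<N. R k)"
        using Rsum by (rule suminf_split_initial_segment)
      moreover have "(\<Sum>k<N. R k) = of_nat (Suc N) powr (1 - s) - 1
         - (\<Sum>j=1..M. ((1 - s) gchoose j) * (\<Sum>k<N. of_nat (Suc k) powr (1 - s - of_nat j)))"
        unfolding R_def by (rule sum_powr_taylor_rem)
      moreover have "A - B = P + T" if "B + S = -1" "S = T + F" "F = P - 1 - A" for A B P T S F :: complex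
        using that by algebra
      ultimately show ?thesis using rec by blast
    qed
    also have "of_nat (Suc N) powr (1 - s) = complex_of_real (real (Suc N) powr (1 - a))"
      unfolding s_def by (subst powr_of_real[symmetric]) auto
    finally have "(\<Sum>j=1..M. ((1 - a) gchoose j) * Szeta (Suc N) (a + real j - 1)) - real (Suc N) powr (1 - a)
        = Re (\<Sum>k. R (k + N))" by simp
    also have "\<bar>\<dots>\<bar> \<le> norm (\<Sum>k. R (k + N))" by (rule abs_Re_le_cmod)
    also have "\<dots> \<le> (\<Sum>k. K * real (Suc (k + N)) powr (- b))"
    proof (rule norm_suminf_le)
      show "norm (R (k + N)) \<le> K * real (Suc (k + N)) powr (- b)" for k
        using powr_taylor_rem_bound[of "Suc (k + N)" M s] a by (simp add: R_def K_def b_def s_def add_ac)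
      show "summable (\<lambda>k. K * real (Suc (k + N)) powr (- b))"
        by (intro summable_mult suminf_powr_tail_le(1) b)
    qed
    also have "\<dots> = K * (\<Sum>k. real (Suc (k + N)) powr (- b))"
      by (rule suminf_mult) (rule suminf_powr_tail_le(1)[OF b])
    also have "\<dots> \<le> K * (2 powr b / (b - 1) * real (Suc N) powr (1 - b))"
      by (intro mult_left_mono suminf_powr_tail_le(2)[OF b]) (simp add: K_def)
    finally show ?thesis by (simp add: mult_ac)
  qed
  show ?thesis
  proof (rule bigoI[of _ "K * (2 powr b / (b - 1))"])
    show "\<forall>\<^sub>F n in sequentially. norm ((\<Sum>j=1..M. ((1 - a) gchoose j) * Szeta n (a + real j - 1)) - real n powr (1 - a))
       \<le> K * (2 powr b / (b - 1)) * norm (real n powr (1 - a - real M))"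
      using eventually_ge_at_top[of 1]
    proof eventually_elim
      case (elim n)
      then obtain N where "n = Suc N" by (cases n) auto
      with bd[of N] show ?case by (simp add: b_def diff_diff_eq del: of_nat_Suc)
    qed
  qed
qed

lemma gbinomial_2: "(a::real) gchoose 2 = a * (a - 1) / 2"
  by (simp add: gbinomial_prod_rev numeral_2_eq_2)

lemma gbinomial_3: "(a::real) gchoose 3 = a * (a - 1) * (a - 2) / 6"
  by (simp add: gbinomial_prod_rev numeral_3_eq_3 fact_numeral)

lemma bigo_cmult: "f \<in> O[F](g) \<Longrightarrow> (\<lambda>x. c * f x :: real) \<in> O[F](g)"
  by (cases "c = 0") simp_all

text \<open>The next three expansions solve \<open>Szeta_recurrence\<close> for its first term with $M = 1, 2, 3$,
  each inserting the previous ones at $a + 1$ and $a + 2$. They are the beginning of the Euler-Maclaurin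
  expansion, continued to the left of the pole.\<close>

lemma Szeta_asymp1:
  assumes "a > 0" "a \<noteq> 1"
  shows "(\<lambda>n. Szeta n a - real n powr (1 - a) / (1 - a)) \<in> O(\<lambda>n. real n powr (- a))"
proof -
  have "(\<lambda>n. (1 - a) * Szeta n a - real n powr (1 - a)) \<in> O(\<lambda>n. real n powr (- a))"
    using Szeta_recurrence[of 1 a] assms by simp
  then have "(\<lambda>n. (1 / (1 - a)) * ((1 - a) * Szeta n a - real n powr (1 - a))) \<in> O(\<lambda>n. real n powr (- a))"
    by (rule bigo_cmult)
  also have "(\<lambda>n. (1 / (1 - a)) * ((1 - a) * Szeta n a - real n powr (1 - a)))
     = (\<lambda>n. Szeta n a - real n powr (1 - a) / (1 - a))"
    using assms by (auto simp: field_simps)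
  finally show ?thesis .
qed

lemma Szeta_asymp2:
  assumes "a > -1" "a \<noteq> 1" "a \<noteq> 0"
  shows "(\<lambda>n. Szeta n a - (real n powr (1 - a) / (1 - a) - real n powr (- a) / 2))
     \<in> O(\<lambda>n. real n powr (- a - 1))"
proof -
  have r: "(\<lambda>n. (1 - a) * Szeta n a + (1 - a) * (- a) / 2 * Szeta n (a + 1) - real n powr (1 - a))
      \<in> O(\<lambda>n. real n powr (- a - 1))"
  proof -
    have S: "(\<Sum>j=1..2. ((1 - a) gchoose j) * Szeta n (a + real j - 1))
        = (1 - a) * Szeta n a + (1 - a) * (- a) / 2 * Szeta n (a + 1)" for n
      by (simp add: numeral_2_eq_2 gbinomial_2[unfolded numeral_2_eq_2] add.commute[of 1 a])
    have pole: "a + real j \<noteq> 1" if "j < 2" for j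
      using that assms by (auto simp: less_Suc_eq numeral_2_eq_2)
    have E: "1 - a - real 2 = - a - 1" by simp
    show ?thesis
      by (rule Szeta_recurrence[of 2 a, unfolded S E]) (use assms pole in auto)
  qed
  have s1: "(\<lambda>n. Szeta n (a + 1) - real n powr (- a) / (- a)) \<in> O(\<lambda>n. real n powr (- a - 1))"
    using Szeta_asymp1[of "a + 1"] assms by simp
  have "(\<lambda>n. (1 / (1 - a)) * ((1 - a) * Szeta n a + (1 - a) * (- a) / 2 * Szeta n (a + 1) - real n powr (1 - a))
       - (- a / 2) * (Szeta n (a + 1) - real n powr (- a) / (- a))) \<in> O(\<lambda>n. real n powr (- a - 1))"
    by (intro sum_in_bigo bigo_cmult r s1)
  also have "(\<lambda>n. (1 / (1 - a)) * ((1 - a) * Szeta n a + (1 - a) * (- a) / 2 * Szeta n (a + 1) - real n powr (1 - a))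
       - (- a / 2) * (Szeta n (a + 1) - real n powr (- a) / (- a)))
     = (\<lambda>n. Szeta n a - (real n powr (1 - a) / (1 - a) - real n powr (- a) / 2))"
    using assms by (auto simp: field_simps)
  finally show ?thesis .
qed

lemma Szeta_asymp3:
  assumes "a > -2" "a \<noteq> 1" "a \<noteq> 0" "a \<noteq> -1"
  shows "(\<lambda>n. Szeta n a - (real n powr (1 - a) / (1 - a) - real n powr (- a) / 2 - a / 12 * real n powr (- a - 1)))
     \<in> O(\<lambda>n. real n powr (- a - 2))"
proof -
  have r: "(\<lambda>n. (1 - a) * Szeta n a + (1 - a) * (- a) / 2 * Szeta n (a + 1)
        + (1 - a) * (- a) * (- a - 1) / 6 * Szeta n (a + 2) - real n powr (1 - a))
      \<in> O(\<lambda>n. real n powr (- a - 2))"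
  proof -
    have S: "(\<Sum>j=1..3. ((1 - a) gchoose j) * Szeta n (a + real j - 1))
        = (1 - a) * Szeta n a + (1 - a) * (- a) / 2 * Szeta n (a + 1)
            + (1 - a) * (- a) * (- a - 1) / 6 * Szeta n (a + 2)" for n
    proof -
      have "(\<Sum>j=1..3. ((1 - a) gchoose j) * Szeta n (a + real j - 1))
        = ((1 - a) gchoose 1) * Szeta n (a + real 1 - 1) + ((1 - a) gchoose 2) * Szeta n (a + real 2 - 1)
          + ((1 - a) gchoose 3) * Szeta n (a + real 3 - 1)"
        by (simp add: numeral_3_eq_3 numeral_2_eq_2)
      moreover have "1 - a - 2 = - a - 1" "a + 3 - 1 = a + 2" "a + 2 - 1 = a + 1" by simp_all
      ultimately show ?thesis by (simp add: gbinomial_2 gbinomial_3 del: gbinomial_1)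
    qed
    have pole: "a + real j \<noteq> 1" if "j < 3" for j
      using that assms by (auto simp: less_Suc_eq numeral_3_eq_3)
    have E: "1 - a - real 3 = - a - 2" by simp
    show ?thesis
      by (rule Szeta_recurrence[of 3 a, unfolded S E]) (use assms pole in auto)
  qed
  have s1: "(\<lambda>n. Szeta n (a + 2) - real n powr (- a - 1) / (- a - 1)) \<in> O(\<lambda>n. real n powr (- a - 2))"
  proof -
    have e: "1 - (a + 2) = - a - 1" "- (a + 2) = - a - 2" by simp_all
    show ?thesis using Szeta_asymp1[of "a + 2"] assms unfolding e by simp
  qed
  have s2: "(\<lambda>n. Szeta n (a + 1) - (real n powr (- a) / (- a) - real n powr (- a - 1) / 2)) \<in> O(\<lambda>n. real n powr (- a - 2))"
  proof -
    have e: "1 - (a + 1) = - a" "- (a + 1) - 1 = - a - 2" "- (a + 1) = - a - 1" "- a - 1 - 1 = - a - 2" by simp_all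
    show ?thesis using Szeta_asymp2[of "a + 1"] assms unfolding e by simp
  qed
  have "(\<lambda>n. (1 / (1 - a)) * ((1 - a) * Szeta n a + (1 - a) * (- a) / 2 * Szeta n (a + 1)
        + (1 - a) * (- a) * (- a - 1) / 6 * Szeta n (a + 2) - real n powr (1 - a))
       - (- a / 2) * (Szeta n (a + 1) - (real n powr (- a) / (- a) - real n powr (- a - 1) / 2))
       - (- a) * (- a - 1) / 6 * (Szeta n (a + 2) - real n powr (- a - 1) / (- a - 1)))
     \<in> O(\<lambda>n. real n powr (- a - 2))"
    by (intro sum_in_bigo bigo_cmult r s1 s2)
  also have "(\<lambda>n. (1 / (1 - a)) * ((1 - a) * Szeta n a + (1 - a) * (- a) / 2 * Szeta n (a + 1)
        + (1 - a) * (- a) * (- a - 1) / 6 * Szeta n (a + 2) - real n powr (1 - a))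
       - (- a / 2) * (Szeta n (a + 1) - (real n powr (- a) / (- a) - real n powr (- a - 1) / 2))
       - (- a) * (- a - 1) / 6 * (Szeta n (a + 2) - real n powr (- a - 1) / (- a - 1)))
     = (\<lambda>n. Szeta n a - (real n powr (1 - a) / (1 - a) - real n powr (- a) / 2 - a / 12 * real n powr (- a - 1)))"
  proof
    fix n
    define P Q R S T U where "P = Szeta n a" "Q = Szeta n (a + 1)" "R = Szeta n (a + 2)"
      "S = real n powr (1 - a)" "T = real n powr (- a)" "U = real n powr (- a - 1)"
    have nz: "1 - a \<noteq> 0" "a \<noteq> 0" "a + 1 \<noteq> 0" "- a - 1 \<noteq> 0" using assms by auto
    have 1: "(1 / (1 - a)) * ((1 - a) * P + (1 - a) * (- a) / 2 * Q + (1 - a) * (- a) * (- a - 1) / 6 * R - S)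
      = P - a / 2 * Q + a * (a + 1) / 6 * R - S / (1 - a)"
      using nz by (simp add: field_simps)
    have 2: "(- a / 2) * (Q - (T / (- a) - U / 2)) = - a / 2 * Q - T / 2 - a / 4 * U"
      using nz by (simp add: field_simps)
    have 3: "(- a) * (- a - 1) / 6 * (R - U / (- a - 1)) = a * (a + 1) / 6 * R + a / 6 * U"
    proof -
      define V where "V = U / (- a - 1)"
      have U: "U = (- a - 1) * V" using nz by (simp add: V_def)
      show ?thesis unfolding V_def[symmetric] unfolding U by (simp add: field_simps)
    qed
    have "(1 / (1 - a)) * ((1 - a) * P + (1 - a) * (- a) / 2 * Q + (1 - a) * (- a) * (- a - 1) / 6 * R - S)
       - (- a / 2) * (Q - (T / (- a) - U / 2)) - (- a) * (- a - 1) / 6 * (R - U / (- a - 1))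
       = P - (S / (1 - a) - T / 2 - a / 12 * U)"
      unfolding 1 2 3 by (simp add: algebra_simps)
    then show "(1 / (1 - a)) * ((1 - a) * Szeta n a + (1 - a) * (- a) / 2 * Szeta n (a + 1)
        + (1 - a) * (- a) * (- a - 1) / 6 * Szeta n (a + 2) - real n powr (1 - a))
       - (- a / 2) * (Szeta n (a + 1) - (real n powr (- a) / (- a) - real n powr (- a - 1) / 2))
       - (- a) * (- a - 1) / 6 * (Szeta n (a + 2) - real n powr (- a - 1) / (- a - 1))
     = Szeta n a - (real n powr (1 - a) / (1 - a) - real n powr (- a) / 2 - a / 12 * real n powr (- a - 1))"
      unfolding P_Q_R_S_T_U_def .
  qed
  finally show ?thesis .
qed

section \<open>The weights and their exactness for quadratics\<close>

text \<open>What the last three weights contain in addition to $k^{-1-\alpha}$; the index is the distance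
  from \<open>n\<close>. The weight at \<open>n\<close> itself has no such summand, as the sum over $k^{-1-\alpha}$
  stops at $n - 1$.\<close>

definition end_corr2 :: "real \<Rightarrow> nat \<Rightarrow> real" where
  "end_corr2 \<alpha> n = - 1/2 * (real n * (real n - 1) * Szeta n (\<alpha> + 1) - (2 * real n - 1) * Szeta n \<alpha>
      + Szeta n (\<alpha> - 1) + (\<alpha> + 2 * real n - 2) * real n powr (1 - \<alpha>) / ((\<alpha> - 2) * (\<alpha> - 1) * \<alpha>))"

definition end_corr1 :: "real \<Rightarrow> nat \<Rightarrow> real" where
  "end_corr1 \<alpha> n = real n * (real n - 2) * Szeta n (\<alpha> + 1) - 2 * (real n - 1) * Szeta n \<alpha>
      + Szeta n (\<alpha> - 1) + 2 * (\<alpha> + real n - 2) * real n powr (1 - \<alpha>) / (\<alpha> * (1 - \<alpha>) * (2 - \<alpha>))"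

definition end_corr0 :: "real \<Rightarrow> nat \<Rightarrow> real" where
  "end_corr0 \<alpha> n = - 1/2 * ((real n - 1) * (real n - 2) * Szeta n (\<alpha> + 1) - (2 * real n - 3) * Szeta n \<alpha>
      + Szeta n (\<alpha> - 1) + (3 * \<alpha> + 2 * real n - 6) * real n powr (1 - \<alpha>) / (\<alpha> * (1 - \<alpha>) * (2 - \<alpha>)))"

text \<open>The brackets after $\zeta(\alpha)$ and $\zeta(\alpha - 1)$ are the one-sided difference quotients
  with step 1 for $-f'(0)$ and $f''(0)$ on the nodes $0, 1, 2$, so they are exact when \<open>f\<close> is
  quadratic in \<open>k\<close>.\<close>

lemma sum_delta:
  assumes n: "n \<ge> 6"
  shows "(\<Sum>k=0..n. delta \<alpha> n k * f k) = (\<Sum>k=1..<n. real k powr (- 1 - \<alpha>) * f k)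
     - zeta_real (1 + \<alpha>) * f 0 + zeta_real \<alpha> * (3/2 * f 0 - 2 * f 1 + 1/2 * f 2)
     - 1/2 * zeta_real (\<alpha> - 1) * (f 0 - 2 * f 1 + f 2)
     + end_corr2 \<alpha> n * f (n - 2) + end_corr1 \<alpha> n * f (n - 1) + end_corr0 \<alpha> n * f n"
proof -
  define z1 z0 zm where "z1 = zeta_real (1 + \<alpha>)" "z0 = zeta_real \<alpha>" "zm = zeta_real (\<alpha> - 1)"
  have delta: "delta \<alpha> n k * f k =
      (if k \<in> {1..<n} then real k powr (- 1 - \<alpha>) * f k else 0)
      + (if k = 0 then (- z1 + 3/2 * z0 - 1/2 * zm) * f 0 else 0)
      + (if k = 1 then (- 2 * z0 + zm) * f 1 else 0)
      + (if k = 2 then (1/2 * z0 - 1/2 * zm) * f 2 else 0)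
      + (if k = n - 2 then end_corr2 \<alpha> n * f (n - 2) else 0)
      + (if k = n - 1 then end_corr1 \<alpha> n * f (n - 1) else 0)
      + (if k = n then end_corr0 \<alpha> n * f n else 0)" if k: "k \<le> n" for k
  proof -
    have p: "1 / real k powr (1 + \<alpha>) = real k powr (- 1 - \<alpha>)"
      using powr_minus_divide[of "real k" "1 + \<alpha>"] by simp
    consider "k = 0" | "k = 1" | "k = 2" | "3 \<le> k" "k + 3 \<le> n" | "k + 2 = n" | "k + 1 = n" | "k = n"
      using k by linarith
    then show ?thesis
    proof cases
      case 1 then show ?thesis using n by (simp add: delta_def z1_z0_zm_def)
    next
      case 2
      have "(1::nat) \<noteq> n - 1" "(1::nat) \<noteq> n - 2" using n by linarith+
      with 2 show ?thesis using n by (simp add: delta_def z1_z0_zm_def algebra_simps)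
    next
      case 3
      have "n - 1 \<noteq> 2" "n - 2 \<noteq> 2" using n by linarith+
      with 3 show ?thesis using n p by (simp add: delta_def z1_z0_zm_def algebra_simps)
    next
      case 4
      then have "k \<noteq> n - 1" "k \<noteq> n - 2" by linarith+
      with 4 show ?thesis using p by (simp add: delta_def)
    next
      case 5
      have ne: "k \<noteq> 0" "k \<noteq> 1" "k \<noteq> 2" "\<not> k + 3 \<le> n" "k \<notin> {0, 1, 2, n - 1, n}" "k \<in> {1..<n}"
        and kn: "k = n - 2" and N: "real n - 2 = real k"
        using 5 n by auto
      have "delta \<alpha> n k = 1 / (real n - 2) powr (1 + \<alpha>) + end_corr2 \<alpha> n"
        unfolding delta_def end_corr2_def Let_def
        by (simp only: ne 5 if_False if_True refl)
      then show ?thesis unfolding N p kn[symmetric] using ne by (simp add: distrib_right)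
    next
      case 6
      have ne: "k \<noteq> 0" "k \<noteq> 1" "k \<noteq> 2" "\<not> k + 3 \<le> n" "k + 2 \<noteq> n" "k \<notin> {0, 1, 2, n - 2, n}" "k \<in> {1..<n}"
        and kn: "k = n - 1" and N: "real n - 1 = real k"
        using 6 n by auto
      have "delta \<alpha> n k = 1 / (real n - 1) powr (1 + \<alpha>) + end_corr1 \<alpha> n"
        unfolding delta_def end_corr1_def Let_def
        by (simp only: ne 6 if_False if_True refl)
      then show ?thesis unfolding N p kn[symmetric] using ne by (simp add: distrib_right)
    next
      case 7
      have "n \<noteq> n - 1" "n \<noteq> n - 2" using n by linarith+
      with 7 show ?thesis using n by (simp add: delta_def end_corr0_def Let_def)
    qed
  qed
  have "(\<Sum>k=0..n. delta \<alpha> n k * f k) =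
      (\<Sum>k=0..n. if k \<in> {1..<n} then real k powr (- 1 - \<alpha>) * f k else 0)
      + (- z1 + 3/2 * z0 - 1/2 * zm) * f 0 + (- 2 * z0 + zm) * f 1
      + (1/2 * z0 - 1/2 * zm) * f 2 + end_corr2 \<alpha> n * f (n - 2)
      + end_corr1 \<alpha> n * f (n - 1) + end_corr0 \<alpha> n * f n"
    using n by (simp add: delta sum.distrib del: sum.cl_ivl_Suc)
  also have "(\<Sum>k=0..n. if k \<in> {1..<n} then real k powr (- 1 - \<alpha>) * f k else 0)
      = (\<Sum>k=1..<n. real k powr (- 1 - \<alpha>) * f k)"
    by (subst sum.inter_restrict[symmetric]) (auto intro!: sum.cong)
  finally have "(\<Sum>k=0..n. delta \<alpha> n k * f k) = (\<Sum>k=1..<n. real k powr (- 1 - \<alpha>) * f k)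
      + (- z1 + 3/2 * z0 - 1/2 * zm) * f 0 + (- 2 * z0 + zm) * f 1
      + (1/2 * z0 - 1/2 * zm) * f 2 + end_corr2 \<alpha> n * f (n - 2)
      + end_corr1 \<alpha> n * f (n - 1) + end_corr0 \<alpha> n * f n" .
  then show ?thesis
    unfolding z1_z0_zm_def[symmetric] by algebra
qed

lemma sum_powr_quadratic:
  "(\<Sum>k=1..<n. real k powr (- 1 - \<alpha>) * (a0 + a1 * real k + a2 * (real k)\<^sup>2))
     = a0 * (Szeta n (\<alpha> + 1) + zeta_real (1 + \<alpha>)) + a1 * (Szeta n \<alpha> + zeta_real \<alpha>)
       + a2 * (Szeta n (\<alpha> - 1) + zeta_real (\<alpha> - 1))"
proof -
  have "real k powr (- 1 - \<alpha>) * (a0 + a1 * real k + a2 * (real k)\<^sup>2)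
      = a0 * real k powr (- (\<alpha> + 1)) + a1 * real k powr (- \<alpha>) + a2 * real k powr (- (\<alpha> - 1))"
    if k: "k \<in> {1..<n}" for k
  proof -
    have "real k powr (- \<alpha>) = real k powr (- 1 - \<alpha>) * real k"
      using k powr_add[of "real k" "- 1 - \<alpha>" 1] by simp
    moreover have "real k powr (- (\<alpha> - 1)) = real k powr (- 1 - \<alpha>) * (real k)\<^sup>2"
      using k powr_add[of "real k" "- 1 - \<alpha>" 2] by (simp add: algebra_simps)
    moreover have "- (\<alpha> + 1) = - 1 - \<alpha>" by simp
    ultimately show ?thesis by (simp add: algebra_simps)
  qed
  then show ?thesis
    by (simp add: Szeta_def sum.distrib sum_distrib_left add.commute[of 1 \<alpha>])
qed

text \<open>The zeta values cancel because the differences at the front are exact for quadratics.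
  The sums $S_n$ cancel because the end corrections extrapolate from the nodes $n, n-1, n-2$ to $0$.
  What remains is the exact integral of the quadratic.\<close>

lemma sum_delta_quadratic:
  assumes n: "n \<ge> 6" and \<alpha>: "0 < \<alpha>" "\<alpha> < 1"
  shows "(\<Sum>k=0..n. delta \<alpha> n k * (a0 + a1 * real k + a2 * (real k)\<^sup>2))
     = a1 * real n powr (1 - \<alpha>) / (\<alpha> * (1 - \<alpha>)) + 2 * a2 * real n powr (2 - \<alpha>) / (\<alpha> * (2 - \<alpha>))"
proof -
  define N P where "N = real n" "P = real n powr (1 - \<alpha>)"
  define S1 S0 Sm where "S1 = Szeta n (\<alpha> + 1)" "S0 = Szeta n \<alpha>" "Sm = Szeta n (\<alpha> - 1)"
  define D where "D = \<alpha> * (1 - \<alpha>) * (2 - \<alpha>)"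
  define X where "X = P / D"
  have D: "(\<alpha> - 2) * (\<alpha> - 1) * \<alpha> = D" by (simp add: D_def algebra_simps)
  have Nm: "real (n - 1) = N - 1" "real (n - 2) = N - 2" using n by (auto simp: N_P_def of_nat_diff)
  have P2: "real n powr (2 - \<alpha>) = N * P"
    using n powr_add[of "real n" "1 - \<alpha>" 1] by (simp add: N_P_def algebra_simps)
  have e2: "end_corr2 \<alpha> n = - 1/2 * (N * (N - 1) * S1 - (2 * N - 1) * S0 + Sm + (\<alpha> + 2 * N - 2) * X)"
    unfolding end_corr2_def D X_def N_P_def S1_S0_Sm_def by simp
  have e1: "end_corr1 \<alpha> n = N * (N - 2) * S1 - 2 * (N - 1) * S0 + Sm + 2 * (\<alpha> + N - 2) * X"
    unfolding end_corr1_def D_def[symmetric] X_def N_P_def S1_S0_Sm_def by simp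
  have e0: "end_corr0 \<alpha> n = - 1/2 * ((N - 1) * (N - 2) * S1 - (2 * N - 3) * S0 + Sm + (3 * \<alpha> + 2 * N - 6) * X)"
    unfolding end_corr0_def D_def[symmetric] X_def N_P_def S1_S0_Sm_def by simp
  have "(\<Sum>k=0..n. delta \<alpha> n k * (a0 + a1 * real k + a2 * (real k)\<^sup>2))
      = a1 * (2 - \<alpha>) * X + 2 * a2 * N * (1 - \<alpha>) * X"
    unfolding sum_delta[OF n] sum_powr_quadratic e2 e1 e0 Nm N_P_def(1)[symmetric] S1_S0_Sm_def[symmetric]
    by (simp add: field_simps power2_eq_square)
  also have "a1 * (2 - \<alpha>) * X = a1 * P / (\<alpha> * (1 - \<alpha>))"
    using \<alpha> by (simp add: X_def D_def divide_simps)
  also have "2 * a2 * N * (1 - \<alpha>) * X = 2 * a2 * (N * P) / (\<alpha> * (2 - \<alpha>))"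
    using \<alpha> by (simp add: X_def D_def divide_simps)
  finally show ?thesis unfolding P2 N_P_def .
qed

section \<open>The corrected trapezoidal rule at an algebraic singularity\<close>

text \<open>The rule is exact for cubic antiderivatives, so only the Taylor remainders of $f_0$, $f_1$, $f_2$
  at the left end contribute.\<close>

lemma corrected_trapezoid:
  fixes f :: "nat \<Rightarrow> real \<Rightarrow> real"
  assumes ab: "a \<le> b"
    and f: "\<And>i t. i \<le> 3 \<Longrightarrow> t \<in> {a..b} \<Longrightarrow> (f i has_real_derivative f (Suc i) t) (at t within {a..b})"
    and B: "\<And>t. t \<in> {a..b} \<Longrightarrow> \<bar>f 4 t\<bar> \<le> B"
  shows "\<bar>f 0 b - f 0 a - (b - a) / 2 * (f 1 a + f 1 b) + (b - a)\<^sup>2 / 12 * (f 2 b - f 2 a)\<bar> \<le> B * (b - a) ^ 4"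
proof -
  define h where "h = b - a"
  have h: "h \<ge> 0" using ab by (simp add: h_def)
  have "norm (f 0 b - (\<Sum>i\<le>3. f i a * (b - a) ^ i / fact i)) \<le> B * norm (b - a) ^ (Suc 3) / fact 3"
    using f B ab by (intro field_Taylor[where S = "{a..b}"]) auto
  then have 0: "\<bar>f 0 b - (f 0 a + f 1 a * h + f 2 a * h^2 / 2 + f 3 a * h^3 / 6)\<bar> \<le> B * h ^ 4 / 6"
    using h by (simp add: h_def numeral_eq_Suc atMost_Suc fact_numeral algebra_simps)
  have "norm (f (1 + 0) b - (\<Sum>i\<le>2. f (1 + i) a * (b - a) ^ i / fact i)) \<le> B * norm (b - a) ^ (Suc 2) / fact 2"
    using f B ab by (intro field_Taylor[where S = "{a..b}" and f = "\<lambda>i. f (1 + i)"]) auto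
  then have 1: "\<bar>f 1 b - (f 1 a + f 2 a * h + f 3 a * h^2 / 2)\<bar> \<le> B * h ^ 3 / 2"
    using h by (simp add: h_def numeral_eq_Suc atMost_Suc fact_numeral algebra_simps)
  have "norm (f (2 + 0) b - (\<Sum>i\<le>1. f (2 + i) a * (b - a) ^ i / fact i)) \<le> B * norm (b - a) ^ (Suc 1) / fact 1"
    using f B ab by (intro field_Taylor[where S = "{a..b}" and f = "\<lambda>i. f (2 + i)"]) auto
  then have 2: "\<bar>f 2 b - (f 2 a + f 3 a * h)\<bar> \<le> B * h ^ 2"
    using h by (simp add: h_def numeral_eq_Suc atMost_Suc fact_numeral algebra_simps)
  define e0 where "e0 = f 0 b - (f 0 a + f 1 a * h + f 2 a * h^2 / 2 + f 3 a * h^3 / 6)"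
  define e1 where "e1 = f 1 b - (f 1 a + f 2 a * h + f 3 a * h^2 / 2)"
  define e2 where "e2 = f 2 b - (f 2 a + f 3 a * h)"
  have "f 0 b - f 0 a - h / 2 * (f 1 a + f 1 b) + h\<^sup>2 / 12 * (f 2 b - f 2 a)
     = e0 - h / 2 * e1 + h\<^sup>2 / 12 * e2"
    (* the Taylor terms cancel: 1 - 1/2 - 1/2 = 0, 1/2 - 1/2 = 0 and 1/6 - 1/4 + 1/12 = 0 *)
    unfolding e0_def e1_def e2_def by (simp add: field_simps power2_eq_square power3_eq_cube)
  also have "\<bar>\<dots>\<bar> \<le> \<bar>e0\<bar> + h / 2 * \<bar>e1\<bar> + h\<^sup>2 / 12 * \<bar>e2\<bar>"
    using h by (intro order_trans[OF abs_triangle_ineq] add_mono order_trans[OF abs_triangle_ineq4])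
       (auto simp: abs_mult)
  also have "\<dots> \<le> B * h ^ 4 / 6 + h / 2 * (B * h ^ 3 / 2) + h\<^sup>2 / 12 * (B * h ^ 2)"
    using 0 1 2 h unfolding e0_def e1_def e2_def by (intro add_mono mult_left_mono) auto
  also have "\<dots> = B * h ^ 4 / 2"
    by (simp add: field_simps power_numeral_reduce)
  also have "\<dots> \<le> B * h ^ 4"
    using B[of a] ab h by (auto simp: mult_nonneg_nonneg intro!: mult_left_le order_trans[OF abs_ge_zero])
  finally show ?thesis unfolding h_def .
qed

text \<open>As \<open>0 powr c = 0\<close>, the bound forces $f(0) = 0$ and $f(t) \to 0$. This suits functions
  $r(t)\, t^{c}$ with negative \<open>c\<close>, whose factor \<open>t powr c\<close> is itself discontinuous at $0$.\<close>

lemma continuous_on_powr_bound: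
  fixes f :: "real \<Rightarrow> real"
  assumes cont: "\<And>t. t \<in> {0<..x} \<Longrightarrow> continuous (at t within {0..x}) f"
    and bd: "\<And>t. t \<in> {0..x} \<Longrightarrow> \<bar>f t\<bar> \<le> C * t powr c" and c: "c > 0"
  shows "continuous_on {0..x} f"
  unfolding continuous_on_eq_continuous_within
proof
  fix t assume t: "t \<in> {0..x}"
  show "continuous (at t within {0..x}) f"
  proof (cases "t = 0")
    case True
    have f0: "f 0 = 0" using bd[of 0] t True by simp
    have "((\<lambda>t. C * t powr c) \<longlongrightarrow> C * 0) (at_right 0)"
      using c by (intro tendsto_mult tendsto_const) real_asymp
    then have "((\<lambda>t. C * t powr c) \<longlongrightarrow> 0) (at_right 0)" by simp
    then have "((\<lambda>t. C * t powr c) \<longlongrightarrow> 0) (at 0 within {0<..x})"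
      by (rule tendsto_within_subset) auto
    moreover have "at 0 within {0..x} = at 0 within {0<..x}"
      by (rule at_within_nhd[of _ UNIV]) auto
    ultimately have "((\<lambda>t. C * t powr c) \<longlongrightarrow> 0) (at 0 within {0..x})" by simp
    then have "(f \<longlongrightarrow> 0) (at 0 within {0..x})"
      by (rule Lim_null_comparison[rotated]) (use bd in \<open>auto simp: eventually_at_filter\<close>)
    then show ?thesis by (simp add: True continuous_within f0)
  qed (use cont t in auto)
qed

lemma DERIV_mult_powr:
  fixes r :: "real \<Rightarrow> real"
  assumes "(r has_real_derivative r') (at t within S)" and "t > 0"
  shows "((\<lambda>t. r t * t powr c) has_real_derivative r' * t powr c + c * (r t * t powr (c - 1))) (at t within S)"
  using assms by (auto intro!: derivative_eq_intros simp: algebra_simps)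

lemma sum_mid_trapezoid:
  fixes v :: "nat \<Rightarrow> real"
  assumes "n \<ge> 1"
  shows "(\<Sum>k=1..<n. v k + v (Suc k)) = 2 * (\<Sum>k=1..<n. v k) + v n - v 1"
proof -
  have "(\<Sum>k=1..<n. v (Suc k) - v k) = v n - v 1"
    using assms by (intro sum_Suc_diff')
  then show ?thesis by (simp add: sum.distrib sum_subtractf)
qed

text \<open>Here $g(t) = r(t)\, t^{-1-\alpha}$ behaves like $t^{2-\alpha}$, with
  $|g'''(t)| = O(t^{-1-\alpha})$. The first panel is of size $h^{3-\alpha}$ altogether. On the panel starting at
  $kh$ the corrected trapezoidal rule has error $O(h^4 (kh)^{-1-\alpha})$; as
  $\sum k^{-1-\alpha}$ converges, these add up to $O(h^{3-\alpha})$ as well. The first conclusion is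
  integration by parts, with \<open>I\<close> the integral of \<open>g\<close>.\<close>

lemma singular_trapezoid:
  fixes r :: "nat \<Rightarrow> real \<Rightarrow> real"
  assumes x: "x > 0" and \<alpha>: "0 < \<alpha>" "\<alpha> < 1"
    and r: "\<And>j t. j \<le> 2 \<Longrightarrow> t \<in> {0..x} \<Longrightarrow> (r j has_real_derivative r (Suc j) t) (at t within {0..x})"
    and bd: "\<And>j t. j \<le> 3 \<Longrightarrow> t \<in> {0..x} \<Longrightarrow> \<bar>r j t\<bar> \<le> C * t ^ (3 - j)"
  obtains I K where "((\<lambda>t. r 1 t * t powr (- \<alpha>)) has_integral (\<alpha> * I + r 0 x * x powr (- \<alpha>))) {0..x}"
    and "\<And>n h. n \<ge> 1 \<Longrightarrow> h = x / real n \<Longrightarrow>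
      \<bar>h * (\<Sum>k=1..<n. r 0 (real k * h) * (real k * h) powr (- 1 - \<alpha>))
        - (I - h / 2 * (r 0 x * x powr (- 1 - \<alpha>))
             + h\<^sup>2 / 12 * (r 1 x * x powr (- 1 - \<alpha>) - (1 + \<alpha>) * (r 0 x * x powr (- 2 - \<alpha>))))\<bar>
      \<le> K * h powr (3 - \<alpha>)"
proof -
  define b where "b = 1 + \<alpha>"
  have b: "b > 1" "b < 2" using \<alpha> by (auto simp: b_def)
  define T where "T = (\<lambda>c j t. r j t * t powr c)"
  have C: "C \<ge> 0" using bd[of 3 x] x by simp
  have T_bound: "\<bar>T c j t\<bar> \<le> C * t powr (c + 3 - real j)" if "j \<le> 3" "t \<in> {0..x}" for c j t
  proof (cases "t = 0")
    case False
    with that have t: "t > 0" by auto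
    have "\<bar>T c j t\<bar> \<le> (C * t ^ (3 - j)) * t powr c"
      using bd[OF that] by (simp add: T_def abs_mult mult_right_mono)
    also have "\<dots> = C * t powr (c + 3 - real j)"
      using t that(1) by (simp add: powr_realpow[symmetric] powr_add[symmetric] of_nat_diff algebra_simps)
    finally show ?thesis .
  qed (simp add: T_def)
  have T_deriv: "(T c j has_real_derivative T c (Suc j) t + c * T (c - 1) j t) (at t within {0..x})"
    if "j \<le> 2" "t \<in> {0<..x}" for c j t
    unfolding T_def by (rule DERIV_mult_powr) (use that r in auto)
  have T_cont: "continuous_on {0..x} (T c j)" if "j \<le> 2" "c + 3 - real j > 0" for c j
    by (rule continuous_on_powr_bound[OF _ T_bound])
      (use that T_deriv in \<open>auto intro!: DERIV_continuous\<close>)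

  (* the derivatives of g by the Leibniz rule, with the powers of t kept inside T *)
  define g where "g = T (- b) 0"
  define g1 where "g1 = (\<lambda>t. T (- b) 1 t - b * T (- b - 1) 0 t)"
  define g2 where "g2 = (\<lambda>t. T (- b) 2 t - 2 * b * T (- b - 1) 1 t + b * (b + 1) * T (- b - 2) 0 t)"
  define g3 where "g3 = (\<lambda>t. T (- b) 3 t - 3 * b * T (- b - 1) 2 t + 3 * b * (b + 1) * T (- b - 2) 1 t
      - b * (b + 1) * (b + 2) * T (- b - 3) 0 t)"
  define G where "G = (\<lambda>t. integral {0..t} g)"
  have g_cont: "continuous_on {0..x} g"
    unfolding g_def by (rule T_cont) (use b in auto)
  have G_deriv: "(G has_real_derivative g t) (at t within {0..x})" if "t \<in> {0..x}" for t
    unfolding G_def by (rule integral_has_real_derivative[OF g_cont that])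
  have Td: "(T c 0 has_real_derivative T c 1 t + c * T (c - 1) 0 t) (at t within {0..x})"
      "(T c 1 has_real_derivative T c 2 t + c * T (c - 1) 1 t) (at t within {0..x})"
      "(T c 2 has_real_derivative T c 3 t + c * T (c - 1) 2 t) (at t within {0..x})"
    if "t \<in> {0<..x}" for t c
    using T_deriv[of 0 t c] T_deriv[of 1 t c] T_deriv[of 2 t c] that
    by (simp_all add: numeral_2_eq_2 numeral_3_eq_3)
  have g_deriv: "(g has_real_derivative g1 t) (at t within {0..x})" if t: "t \<in> {0<..x}" for t
    unfolding g_def g1_def using Td(1)[OF t, of "- b"] by simp
  have g1_deriv: "(g1 has_real_derivative g2 t) (at t within {0..x})" if t: "t \<in> {0<..x}" for t
    unfolding g1_def g2_def
    by (rule derivative_eq_intros Td t refl)+ (simp add: algebra_simps)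
  have g2_deriv: "(g2 has_real_derivative g3 t) (at t within {0..x})" if t: "t \<in> {0<..x}" for t
    unfolding g2_def g3_def
    by (rule derivative_eq_intros Td t refl)+ (simp add: algebra_simps)
  define K3 where "K3 = C * (1 + 3 * b + 3 * b * (b + 1) + b * (b + 1) * (b + 2))"
  have K3: "K3 \<ge> 0" using C b by (simp add: K3_def)
  have g3_bound: "\<bar>g3 t\<bar> \<le> K3 * t powr (- b)" if t: "t \<in> {0..x}" for t
  proof -
    have "\<bar>g3 t\<bar> \<le> \<bar>T (- b) 3 t\<bar> + 3 * b * \<bar>T (- b - 1) 2 t\<bar> + 3 * b * (b + 1) * \<bar>T (- b - 2) 1 t\<bar>
        + b * (b + 1) * (b + 2) * \<bar>T (- b - 3) 0 t\<bar>"
    proof -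
      have tri: "\<bar>p - q + u - v\<bar> \<le> \<bar>p\<bar> + \<bar>q\<bar> + \<bar>u\<bar> + \<bar>v\<bar>" for p q u v :: real by linarith
      show ?thesis unfolding g3_def
        by (rule order_trans[OF tri]) (use b in \<open>simp add: abs_mult\<close>)
    qed
    also have "\<dots> \<le> C * t powr (- b) + 3 * b * (C * t powr (- b)) + 3 * b * (b + 1) * (C * t powr (- b))
        + b * (b + 1) * (b + 2) * (C * t powr (- b))"
      using T_bound[of 3 t "- b"] T_bound[of 2 t "- b - 1"] T_bound[of 1 t "- b - 2"] T_bound[of 0 t "- b - 3"] t b
      by (intro add_mono mult_left_mono) auto
    also have "\<dots> = K3 * t powr (- b)" by (simp add: K3_def algebra_simps)
    finally show ?thesis .
  qed

  define f where "f = (\<lambda>i. if i = 0 then G else if i = 1 then g else if i = 2 then g1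
      else if i = (3::nat) then g2 else g3)"
  have f_deriv: "(f i has_real_derivative f (Suc i) t) (at t within {0..x})"
    if "i \<le> 3" "t \<in> {0<..x}" for i t
  proof -
    have "i = 0 \<or> i = 1 \<or> i = 2 \<or> i = 3" using that(1) by linarith
    then show ?thesis
      using that(2) G_deriv g_deriv g1_deriv g2_deriv by (auto simp: f_def)
  qed

  define I where "I = G x"
  define Z where "Z = (\<Sum>k. real (Suc k) powr (- b))"
  define K where "K = K3 * Z + C + C / 2 + C * (1 + b) / 12"
  have "((\<lambda>t. r 1 t * t powr (- \<alpha>)) has_integral (\<alpha> * I + r 0 x * x powr (- \<alpha>))) {0..x}"
  proof -
    have "((\<lambda>t. T (- \<alpha>) 1 t - \<alpha> * g t) has_integral (T (- \<alpha>) 0 x - T (- \<alpha>) 0 0)) {0..x}"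
    proof (rule fundamental_theorem_of_calculus_interior)
      show "continuous_on {0..x} (T (- \<alpha>) 0)" by (rule T_cont) (use \<alpha> in auto)
      fix t assume t: "t \<in> {0<..<x}"
      have "(T (- \<alpha>) 0 has_real_derivative T (- \<alpha>) 1 t - \<alpha> * g t) (at t within {0..x})"
      proof -
        have "- b = - \<alpha> - 1" by (simp add: b_def)
        then show ?thesis using Td(1)[of t "- \<alpha>"] t by (simp add: g_def)
      qed
      moreover have "at t within {0..x} = at t"
        using t by (intro at_within_interior) auto
      ultimately show "(T (- \<alpha>) 0 has_vector_derivative T (- \<alpha>) 1 t - \<alpha> * g t) (at t)"
        by (simp add: has_real_derivative_iff_has_vector_derivative)
    qed (use x in auto)
    moreover have "((\<lambda>t. \<alpha> * g t) has_integral \<alpha> * I) {0..x}"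
      unfolding I_def G_def
      by (intro has_integral_mult_right integrable_integral integrable_continuous_real g_cont)
    ultimately have "((\<lambda>t. (T (- \<alpha>) 1 t - \<alpha> * g t) + \<alpha> * g t) has_integral
        ((T (- \<alpha>) 0 x - T (- \<alpha>) 0 0) + \<alpha> * I)) {0..x}"
      by (rule has_integral_add)
    then show ?thesis by (simp add: T_def add_ac)
  qed
  moreover have "\<bar>h * (\<Sum>k=1..<n. r 0 (real k * h) * (real k * h) powr (- 1 - \<alpha>))
        - (I - h / 2 * (r 0 x * x powr (- 1 - \<alpha>))
             + h\<^sup>2 / 12 * (r 1 x * x powr (- 1 - \<alpha>) - (1 + \<alpha>) * (r 0 x * x powr (- 2 - \<alpha>))))\<bar>
      \<le> K * h powr (3 - \<alpha>)" if n: "n \<ge> 1" and h: "h = x / real n" for n h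
  proof -
    have h0: "h > 0" using x n h by simp
    have nh: "real n * h = x" using n h by simp
    have kh: "real k * h \<in> {0<..x}" if "1 \<le> k" "k \<le> n" for k
      using that h0 nh mult_right_mono[of "real k" "real n" h] by auto
    have hx: "h \<in> {0..x}" using kh[of 1] n by simp
    define \<epsilon> where "\<epsilon> = (\<lambda>k. G (real (Suc k) * h) - G (real k * h)
        - h / 2 * (g (real k * h) + g (real (Suc k) * h))
        + h\<^sup>2 / 12 * (g1 (real (Suc k) * h) - g1 (real k * h)))"
    have eps: "\<bar>\<epsilon> k\<bar> \<le> K3 * h powr (3 - \<alpha>) * real k powr (- b)" if k: "k \<in> {1..<n}" for k
    proof -
      define u v where "u = real k * h" "v = real (Suc k) * h"
      have uv: "v - u = h" "u \<le> v" "u > 0" "v \<le> x"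
        using k h0 kh[of k] kh[of "Suc k"] by (auto simp: u_v_def algebra_simps)
      have sub: "{u..v} \<subseteq> {0..x}" "{u..v} \<subseteq> {0<..x}" using uv by auto
      have "\<bar>f 0 v - f 0 u - (v - u) / 2 * (f 1 u + f 1 v) + (v - u)\<^sup>2 / 12 * (f 2 v - f 2 u)\<bar>
          \<le> (K3 * u powr (- b)) * (v - u) ^ 4"
      proof (rule corrected_trapezoid)
        show "(f i has_real_derivative f (Suc i) t) (at t within {u..v})" if "i \<le> 3" "t \<in> {u..v}" for i t
          by (rule DERIV_subset[OF f_deriv sub(1)]) (use that sub in auto)
        show "\<bar>f 4 t\<bar> \<le> K3 * u powr (- b)" if t: "t \<in> {u..v}" for t
        proof -
          have "\<bar>f 4 t\<bar> \<le> K3 * t powr (- b)" using g3_bound[of t] t sub by (auto simp: f_def)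
          also have "\<dots> \<le> K3 * u powr (- b)"
            using t uv b K3 by (intro mult_left_mono powr_mono2') auto
          finally show ?thesis .
        qed
      qed (use uv in auto)
      then have "\<bar>\<epsilon> k\<bar> \<le> K3 * (u powr (- b) * h ^ 4)"
        unfolding uv(1) by (simp add: f_def \<epsilon>_def u_v_def mult.assoc)
      also have "u powr (- b) * h ^ 4 = h powr (3 - \<alpha>) * real k powr (- b)"
      proof -
        have "h powr (- b) * h ^ 4 = h powr (3 - \<alpha>)"
          using powr_add[of h "- b" 4] h0 by (simp add: b_def)
        moreover have "u powr (- b) = real k powr (- b) * h powr (- b)"
          using h0 by (simp add: u_v_def powr_mult)
        ultimately show ?thesis by (metis mult.assoc mult.commute)
      qed
      finally show ?thesis by (simp add: mult_ac)
    qed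
    have sum_eps: "\<bar>\<Sum>k=1..<n. \<epsilon> k\<bar> \<le> K3 * Z * h powr (3 - \<alpha>)"
    proof -
      have sm: "summable (\<lambda>k. real (Suc k) powr (- b))"
        by (subst summable_Suc_iff) (use b in \<open>simp add: summable_real_powr_iff\<close>)
      have "\<bar>\<Sum>k=1..<n. \<epsilon> k\<bar> \<le> (\<Sum>k=1..<n. K3 * h powr (3 - \<alpha>) * real k powr (- b))"
        by (rule sum_abs[THEN order_trans]) (intro sum_mono eps)
      also have "\<dots> = K3 * h powr (3 - \<alpha>) * (\<Sum>k=1..<n. real k powr (- b))"
        by (simp add: sum_distrib_left)
      also have "(\<Sum>k=1..<n. real k powr (- b)) = (\<Sum>k<n-1. real (Suc k) powr (- b))"
        using n by (intro sum.reindex_bij_witness[of _ Suc "\<lambda>k. k - 1"]) auto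
      also have "K3 * h powr (3 - \<alpha>) * \<dots> \<le> K3 * h powr (3 - \<alpha>) * Z"
        unfolding Z_def using K3 by (intro mult_left_mono sum_le_suminf sm) auto
      finally show ?thesis by (simp add: mult_ac)
    qed
    have "(\<Sum>k=1..<n. \<epsilon> k) = (\<Sum>k=1..<n. G (real (Suc k) * h) - G (real k * h))
        - h / 2 * (\<Sum>k=1..<n. g (real k * h) + g (real (Suc k) * h))
        + h\<^sup>2 / 12 * (\<Sum>k=1..<n. g1 (real (Suc k) * h) - g1 (real k * h))"
      unfolding \<epsilon>_def by (simp only: sum.distrib sum_subtractf sum_distrib_left[symmetric])
    also have "(\<Sum>k=1..<n. G (real (Suc k) * h) - G (real k * h)) = I - G h"
      using sum_Suc_diff'[of 1 n "\<lambda>k. G (real k * h)"] n nh by (simp add: I_def)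
    also have "(\<Sum>k=1..<n. g1 (real (Suc k) * h) - g1 (real k * h)) = g1 x - g1 h"
      using sum_Suc_diff'[of 1 n "\<lambda>k. g1 (real k * h)"] n nh by simp
    also have "(\<Sum>k=1..<n. g (real k * h) + g (real (Suc k) * h))
        = 2 * (\<Sum>k=1..<n. g (real k * h)) + g x - g h"
      using sum_mid_trapezoid[of n "\<lambda>k. g (real k * h)"] n nh by simp
    finally have "(\<Sum>k=1..<n. \<epsilon> k) = I - G h
        - h / 2 * (2 * (\<Sum>k=1..<n. g (real k * h)) + g x - g h) + h\<^sup>2 / 12 * (g1 x - g1 h)" .
    moreover have "h * S - (I - h / 2 * gx + q * gx') = h / 2 * gh - Gh - q * gh' - E"
      if "E = I - Gh - h / 2 * (2 * S + gx - gh) + q * (gx' - gh')" for E S Gh gx gh gx' gh' q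
      using that by (simp add: field_simps)
    ultimately have "h * (\<Sum>k=1..<n. g (real k * h)) - (I - h / 2 * g x + h\<^sup>2 / 12 * g1 x)
        = h / 2 * g h - G h - h\<^sup>2 / 12 * g1 h - (\<Sum>k=1..<n. \<epsilon> k)"
      by blast
    also have "\<bar>\<dots>\<bar> \<le> h / 2 * \<bar>g h\<bar> + \<bar>G h\<bar> + h\<^sup>2 / 12 * \<bar>g1 h\<bar> + \<bar>\<Sum>k=1..<n. \<epsilon> k\<bar>"
    proof -
      have tri: "\<bar>p - q - u - v\<bar> \<le> \<bar>p\<bar> + \<bar>q\<bar> + \<bar>u\<bar> + \<bar>v\<bar>" for p q u v :: real by linarith
      show ?thesis by (rule order_trans[OF tri]) (use h0 in \<open>simp add: abs_mult\<close>)
    qed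
    also have "\<dots> \<le> h / 2 * (C * h powr (2 - \<alpha>)) + C * h powr (2 - \<alpha>) * h
        + h\<^sup>2 / 12 * (C * (1 + b) * h powr (1 - \<alpha>)) + K3 * Z * h powr (3 - \<alpha>)"
    proof (intro add_mono mult_left_mono sum_eps)
      show "\<bar>g h\<bar> \<le> C * h powr (2 - \<alpha>)"
        using T_bound[of 0 h "- b"] hx by (simp add: g_def b_def)
      have "\<bar>T (- b) 1 h\<bar> \<le> C * h powr (1 - \<alpha>)" "\<bar>T (- b - 1) 0 h\<bar> \<le> C * h powr (1 - \<alpha>)"
        using T_bound[of 1 h "- b"] T_bound[of 0 h "- b - 1"] hx by (simp_all add: b_def)
      then have "\<bar>T (- b) 1 h\<bar> + b * \<bar>T (- b - 1) 0 h\<bar> \<le> C * h powr (1 - \<alpha>) + b * (C * h powr (1 - \<alpha>))"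
        using b by (intro add_mono mult_left_mono) auto
      moreover have "\<bar>g1 h\<bar> \<le> \<bar>T (- b) 1 h\<bar> + b * \<bar>T (- b - 1) 0 h\<bar>"
        unfolding g1_def using b by (intro order_trans[OF abs_triangle_ineq4]) (simp add: abs_mult)
      ultimately show "\<bar>g1 h\<bar> \<le> C * (1 + b) * h powr (1 - \<alpha>)" by (simp add: algebra_simps)
      have "norm (integral {0..h} g) \<le> C * h powr (2 - \<alpha>) * (h - 0)"
      proof (rule integral_bound)
        show "continuous_on {0..h} g" by (rule continuous_on_subset[OF g_cont]) (use hx in auto)
        fix t assume t: "t \<in> {0..h}"
        have "\<bar>g t\<bar> \<le> C * t powr (2 - \<alpha>)"
          using T_bound[of 0 t "- b"] hx t by (simp add: g_def b_def)
        also have "\<dots> \<le> C * h powr (2 - \<alpha>)"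
          using t \<alpha> C by (intro mult_left_mono powr_mono2) auto
        finally show "norm (g t) \<le> C * h powr (2 - \<alpha>)" by simp
      qed (use h0 in auto)
      then show "\<bar>G h\<bar> \<le> C * h powr (2 - \<alpha>) * h" by (simp add: G_def)
    qed (use h0 in auto)
    also have "\<dots> = K * h powr (3 - \<alpha>)"
    proof -
      have A1: "h * h powr (2 - \<alpha>) = h powr (3 - \<alpha>)"
        using powr_add[of h 1 "2 - \<alpha>"] h0 by simp
      have A2: "h\<^sup>2 * h powr (1 - \<alpha>) = h powr (3 - \<alpha>)"
        using powr_add[of h 2 "1 - \<alpha>"] h0 by simp
      have A3: "h / 2 * (C * p) + C * p * h + h\<^sup>2 / 12 * (C * (1 + b) * q) + K3 * Z * w
          = (C + C / 2) * (h * p) + C * (1 + b) / 12 * (h\<^sup>2 * q) + K3 * Z * w" for p q w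
        by (simp add: field_simps)
      show ?thesis unfolding A3 A1 A2 K_def by (simp add: field_simps)
    qed
    finally have F: "\<bar>h * (\<Sum>k=1..<n. g (real k * h)) - (I - h / 2 * g x + h\<^sup>2 / 12 * g1 x)\<bar>
        \<le> K * h powr (3 - \<alpha>)" .
    have e: "- (1 + \<alpha>) = - 1 - \<alpha>" "- 1 - \<alpha> - 1 = - 2 - \<alpha>" by simp_all
    show ?thesis
      using F unfolding g_def g1_def T_def b_def e .
  qed
  ultimately show thesis by (rule that)
qed

section \<open>Bounds for the end corrections\<close>

text \<open>After inserting the expansion of the $S_n$ up to the second term, all powers of \<open>n\<close> cancel
  identically, and only the error terms \<open>e1\<close>, \<open>e0\<close>, \<open>em\<close> remain, with
  coefficients of degree 2, 1 and 0 in \<open>n\<close>.\<close>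

lemma end_corr_bounded:
  assumes \<alpha>: "0 < \<alpha>" "\<alpha> < 1"
  shows "end_corr1 \<alpha> \<in> O(\<lambda>n. 1)" and "end_corr2 \<alpha> \<in> O(\<lambda>n. 1)"
proof -
  define e1 where "e1 = (\<lambda>n. Szeta n (\<alpha> + 1) - (real n powr (- \<alpha>) / (- \<alpha>) - real n powr (- \<alpha> - 1) / 2))"
  define e0 where "e0 = (\<lambda>n. Szeta n \<alpha> - (real n powr (1 - \<alpha>) / (1 - \<alpha>) - real n powr (- \<alpha>) / 2))"
  define em where "em = (\<lambda>n. Szeta n (\<alpha> - 1) - (real n powr (2 - \<alpha>) / (2 - \<alpha>) - real n powr (1 - \<alpha>) / 2))"
  have e1: "e1 \<in> O(\<lambda>n. real n powr (- \<alpha> - 2))"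
  proof -
    have e: "1 - (\<alpha> + 1) = - \<alpha>" "- (\<alpha> + 1) - 1 = - \<alpha> - 2" "- (\<alpha> + 1) = - \<alpha> - 1" "- \<alpha> - 1 - 1 = - \<alpha> - 2"
      by simp_all
    show ?thesis using Szeta_asymp2[of "\<alpha> + 1"] \<alpha> unfolding e e1_def by simp
  qed
  have e0: "e0 \<in> O(\<lambda>n. real n powr (- \<alpha> - 1))"
    using Szeta_asymp2[of \<alpha>] \<alpha> unfolding e0_def by simp
  have em: "em \<in> O(\<lambda>n. real n powr (- \<alpha>))"
  proof -
    have e: "1 - (\<alpha> - 1) = 2 - \<alpha>" "- (\<alpha> - 1) - 1 = - \<alpha>" "- (\<alpha> - 1) = 1 - \<alpha>" "1 - \<alpha> - 1 = - \<alpha>"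
      by simp_all
    show ?thesis using Szeta_asymp2[of "\<alpha> - 1"] \<alpha> unfolding e em_def by simp
  qed
  have prod: "(\<lambda>n. p n * e n) \<in> O(\<lambda>n. 1)"
    if "e \<in> O(\<lambda>n. real n powr d)" "(\<lambda>n. p n * real n powr d) \<in> O(\<lambda>n. 1)" for p e :: "nat \<Rightarrow> real" and d
    using landau_o.big.mult_left[OF that(1), of p] that(2) by (rule landau_o.big_trans)
  have eq: "end_corr1 \<alpha> n = real n * (real n - 2) * e1 n - 2 * (real n - 1) * e0 n + 1 * em n"
    "end_corr2 \<alpha> n = (- 1/2) * (real n * (real n - 1) * e1 n) + 1/2 * ((2 * real n - 1) * e0 n) - 1/2 * (1 * em n)"
    if n: "n \<ge> 1" for n
  proof -
    define N Q where "N = real n" "Q = real n powr (- \<alpha> - 1)"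
    have P: "real n powr (- \<alpha>) = N * Q" using n powr_add[of "real n" "- \<alpha> - 1" 1] by (simp add: N_Q_def)
    have Q: "real n powr (- \<alpha> - 1) = Q" by (simp add: N_Q_def)
    have P1: "real n powr (1 - \<alpha>) = N * N * Q"
      using n powr_add[of "real n" "- \<alpha> - 1" 2] by (simp add: N_Q_def power2_eq_square algebra_simps)
    have P2: "real n powr (2 - \<alpha>) = N * N * N * Q"
      using n powr_add[of "real n" "- \<alpha> - 1" 3] by (simp add: N_Q_def power3_eq_cube algebra_simps)
    define D where "D = 1 / (\<alpha> * (1 - \<alpha>) * (2 - \<alpha>))"
    have inv: "1 / (- \<alpha>) = - (1 - \<alpha>) * (2 - \<alpha>) * D" "1 / (1 - \<alpha>) = \<alpha> * (2 - \<alpha>) * D"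
      "1 / (2 - \<alpha>) = \<alpha> * (1 - \<alpha>) * D" "1 / ((\<alpha> - 2) * (\<alpha> - 1) * \<alpha>) = D"
      using \<alpha> by (simp_all add: D_def divide_simps) (simp add: algebra_simps)
    define S1 S0 Sm where "S1 = Szeta n (\<alpha> + 1)" "S0 = Szeta n \<alpha>" "Sm = Szeta n (\<alpha> - 1)"
    have dv: "u / v = u * (1 / v)" for u v :: real by simp
    have E1: "e1 n = S1 - (N * Q * (- (1 - \<alpha>) * (2 - \<alpha>) * D) - Q * (1 / 2))"
      unfolding e1_def P Q unfolding S1_S0_Sm_def[symmetric] N_Q_def(1)[symmetric]
      by (subst dv, subst (2) dv) (simp only: inv)
    have E0: "e0 n = S0 - (N * N * Q * (\<alpha> * (2 - \<alpha>) * D) - N * Q * (1 / 2))"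
      unfolding e0_def P1 P unfolding S1_S0_Sm_def[symmetric] N_Q_def(1)[symmetric]
      by (subst dv, subst (2) dv) (simp only: inv)
    have Em: "em n = Sm - (N * N * N * Q * (\<alpha> * (1 - \<alpha>) * D) - N * N * Q * (1 / 2))"
      unfolding em_def P1 P2 unfolding S1_S0_Sm_def[symmetric] N_Q_def(1)[symmetric]
      by (subst dv, subst (2) dv) (simp only: inv)
    have C1: "end_corr1 \<alpha> n = N * (N - 2) * S1 - 2 * (N - 1) * S0 + Sm + 2 * (\<alpha> + N - 2) * (N * N * Q) * D"
      unfolding end_corr1_def P1 unfolding S1_S0_Sm_def[symmetric] N_Q_def(1)[symmetric] D_def by simp
    have C2: "end_corr2 \<alpha> n = - 1/2 * (N * (N - 1) * S1 - (2 * N - 1) * S0 + Sm + (\<alpha> + 2 * N - 2) * (N * N * Q) * D)"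
      unfolding end_corr2_def P1 unfolding S1_S0_Sm_def[symmetric] N_Q_def(1)[symmetric]
      by (subst dv) (simp only: inv)
    show "end_corr1 \<alpha> n = real n * (real n - 2) * e1 n - 2 * (real n - 1) * e0 n + 1 * em n"
      unfolding C1 E1 E0 Em N_Q_def(1)[symmetric] by (simp add: field_simps)
    show "end_corr2 \<alpha> n = (- 1/2) * (real n * (real n - 1) * e1 n) + 1/2 * ((2 * real n - 1) * e0 n) - 1/2 * (1 * em n)"
      unfolding C2 E1 E0 Em N_Q_def(1)[symmetric] by (simp add: field_simps)
  qed
  have a: "(\<lambda>n. real n * (real n - 2) * real n powr (- \<alpha> - 2)) \<in> O(\<lambda>n. 1)"
    "(\<lambda>n. real n * (real n - 1) * real n powr (- \<alpha> - 2)) \<in> O(\<lambda>n. 1)"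
    "(\<lambda>n. 2 * (real n - 1) * real n powr (- \<alpha> - 1)) \<in> O(\<lambda>n. 1)"
    "(\<lambda>n. (2 * real n - 1) * real n powr (- \<alpha> - 1)) \<in> O(\<lambda>n. 1)"
    "(\<lambda>n. 1 * real n powr (- \<alpha>)) \<in> O(\<lambda>n. 1)"
    using \<alpha> by real_asymp+
  have "(\<lambda>n. real n * (real n - 2) * e1 n - 2 * (real n - 1) * e0 n + 1 * em n) \<in> O(\<lambda>n. 1)"
    by (intro sum_in_bigo prod[OF e1 a(1)] prod[OF e0 a(3)] prod[OF em a(5)])
  then show "end_corr1 \<alpha> \<in> O(\<lambda>n. 1)"
    by (rule landau_o.big.in_cong[THEN iffD2, rotated]) (use eq(1) in \<open>auto simp: eventually_at_top_linorder\<close>)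
  have "(\<lambda>n. (- 1/2) * (real n * (real n - 1) * e1 n) + 1/2 * ((2 * real n - 1) * e0 n) - 1/2 * (1 * em n)) \<in> O(\<lambda>n. 1)"
    by (intro sum_in_bigo bigo_cmult prod[OF e1 a(2)] prod[OF e0 a(4)] prod[OF em a(5)])
  then show "end_corr2 \<alpha> \<in> O(\<lambda>n. 1)"
    by (rule landau_o.big.in_cong[THEN iffD2, rotated]) (use eq(2) in \<open>auto simp: eventually_at_top_linorder\<close>)
qed

text \<open>For $a = 1 + \alpha - j$ the three terms are the finite part of the integral of $t^{j-1-\alpha}$
  over $[0,x]$, minus $h/2$ times the integrand at $x$, plus $h^2/12$ times its derivative at $x$. These are the
  quantities of \<open>singular_trapezoid\<close>, now for a function that is too singular at $0$ for that lemma.\<close>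

lemma Szeta_scaled:
  assumes x: "x > 0" and \<alpha>: "0 < \<alpha>" and a: "a > -2" "a \<noteq> 1" "a \<noteq> 0" "a \<noteq> -1"
  shows "(\<lambda>n. (x / real n) powr (1 - a) * Szeta n a
      - (x powr (1 - a) / (1 - a) - (x / real n) / 2 * x powr (- a) - a / 12 * (x / real n)\<^sup>2 * x powr (- a - 1)))
    \<in> O(\<lambda>n. (x / real n) powr (3 - \<alpha>))"
proof -
  have "(\<lambda>n. (x / real n) powr (1 - a) * (Szeta n a
       - (real n powr (1 - a) / (1 - a) - real n powr (- a) / 2 - a / 12 * real n powr (- a - 1))))
     \<in> O(\<lambda>n. (x / real n) powr (1 - a) * real n powr (- a - 2))"
    by (rule landau_o.big.mult_left[OF Szeta_asymp3[OF a]])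
  also have "(\<lambda>n. (x / real n) powr (1 - a) * real n powr (- a - 2)) \<in> O(\<lambda>n. (x / real n) powr (3 - \<alpha>))"
    using x \<alpha> by real_asymp
  finally have *: "(\<lambda>n. (x / real n) powr (1 - a) * (Szeta n a
       - (real n powr (1 - a) / (1 - a) - real n powr (- a) / 2 - a / 12 * real n powr (- a - 1))))
     \<in> O(\<lambda>n. (x / real n) powr (3 - \<alpha>))" .
  have eq: "(x / real n) powr (1 - a) * (Szeta n a
       - (real n powr (1 - a) / (1 - a) - real n powr (- a) / 2 - a / 12 * real n powr (- a - 1)))
     = (x / real n) powr (1 - a) * Szeta n a
      - (x powr (1 - a) / (1 - a) - (x / real n) / 2 * x powr (- a) - a / 12 * (x / real n)\<^sup>2 * x powr (- a - 1))"
    if n: "n \<ge> 1" for n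
  proof -
    define h where "h = x / real n"
    have h: "h > 0" "real n = x / h" using x n by (auto simp: h_def)
    have 1: "h powr (1 - a) * real n powr (1 - a) = x powr (1 - a)"
      using h x by (simp add: powr_divide)
    have 2: "h powr (1 - a) * real n powr (- a) = h * x powr (- a)"
      using h x powr_add[of h "- a" 1] by (simp add: powr_divide)
    have 3: "h powr (1 - a) * real n powr (- a - 1) = h\<^sup>2 * x powr (- a - 1)"
      using h x powr_add[of h "- a - 1" 2] by (simp add: powr_divide)
    show ?thesis unfolding h_def[symmetric]
      using 1 2 3 by (simp add: algebra_simps)
  qed
  show ?thesis
    by (rule landau_o.big.in_cong[THEN iffD1, OF _ *])
      (use eq in \<open>auto simp: eventually_at_top_linorder intro!: exI[of _ 1]\<close>)
qed

lemma taylor_quadratic: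
  fixes U :: "nat \<Rightarrow> real \<Rightarrow> real"
  assumes U: "\<And>j t. j \<le> 2 \<Longrightarrow> t \<in> {0..x} \<Longrightarrow> (U j has_real_derivative U (Suc j) t) (at t within {0..x})"
    and B: "\<And>t. t \<in> {0..x} \<Longrightarrow> \<bar>U 3 t\<bar> \<le> B" and w: "w \<in> {0..x}" and z: "z \<in> {0..x}"
  shows "\<bar>U 0 z - (U 0 w + U 1 w * (z - w) + U 2 w * (z - w)\<^sup>2 / 2)\<bar> \<le> B * \<bar>z - w\<bar> ^ 3"
    and "\<bar>U 1 z - (U 1 w + U 2 w * (z - w))\<bar> \<le> B * \<bar>z - w\<bar>\<^sup>2"
    and "\<bar>U 2 z - U 2 w\<bar> \<le> B * \<bar>z - w\<bar>"
proof -
  have B0: "B \<ge> 0" using B[OF w] by linarith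
  have T: "norm (U (2 - n + 0) z - (\<Sum>i\<le>n. U (2 - n + i) w * (z - w) ^ i / fact i)) \<le> B * norm (z - w) ^ Suc n / fact n"
    if "n \<le> 2" for n
  proof (rule field_Taylor[where S = "{0..x}" and f = "\<lambda>i. U (2 - n + i)"])
    show "(U (2 - n + i) has_real_derivative U (2 - n + Suc i) t) (at t within {0..x})"
      if "t \<in> {0..x}" "i \<le> n" for i t
      using U[of "2 - n + i" t] that \<open>n \<le> 2\<close> by simp
    have e: "2 - n + Suc n = 3" using that by simp
    show "norm (U (2 - n + Suc n) t) \<le> B" if "t \<in> {0..x}" for t
      using B[OF that] unfolding e by simp
  qed (use w z in auto)
  have "\<bar>U 0 z - (U 0 w + U 1 w * (z - w) + U 2 w * (z - w)\<^sup>2 / 2)\<bar> \<le> B * \<bar>z - w\<bar> ^ 3 / 2"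
    using T[of 2] by (simp add: numeral_2_eq_2 numeral_3_eq_3)
  also have "\<dots> \<le> B * \<bar>z - w\<bar> ^ 3" using B0 by simp
  finally show "\<bar>U 0 z - (U 0 w + U 1 w * (z - w) + U 2 w * (z - w)\<^sup>2 / 2)\<bar> \<le> B * \<bar>z - w\<bar> ^ 3" .
  show "\<bar>U 1 z - (U 1 w + U 2 w * (z - w))\<bar> \<le> B * \<bar>z - w\<bar>\<^sup>2"
    using T[of 1] by (simp add: numeral_2_eq_2)
  show "\<bar>U 2 z - U 2 w\<bar> \<le> B * \<bar>z - w\<bar>"
    using T[of 0] by simp
qed

section \<open>Convergence of the scheme\<close>

lemma has_integral_quadratic_powr:
  fixes x \<alpha> a1 a2 :: real
  assumes x: "x > 0" and \<alpha>: "0 < \<alpha>" "\<alpha> < 1"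
  shows "((\<lambda>t. (a1 + 2 * a2 * t) * t powr (- \<alpha>)) has_integral
           (a1 * x powr (1 - \<alpha>) / (1 - \<alpha>) + 2 * a2 * x powr (2 - \<alpha>) / (2 - \<alpha>))) {0..x}"
proof -
  have e: "- \<alpha> + 1 = 1 - \<alpha>" "1 - \<alpha> + 1 = 2 - \<alpha>" by simp_all
  have "((\<lambda>t. t powr (- \<alpha>)) has_integral (x powr (1 - \<alpha>) / (1 - \<alpha>))) {0..x}"
    using has_integral_powr_from_0[of "- \<alpha>" x] x \<alpha> by (simp add: e)
  moreover have "((\<lambda>t. t powr (1 - \<alpha>)) has_integral (x powr (2 - \<alpha>) / (2 - \<alpha>))) {0..x}"
    using has_integral_powr_from_0[of "1 - \<alpha>" x] x \<alpha> by (simp add: e)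
  ultimately have "((\<lambda>t. a1 * t powr (- \<alpha>) + (2 * a2) * t powr (1 - \<alpha>)) has_integral
      (a1 * (x powr (1 - \<alpha>) / (1 - \<alpha>)) + (2 * a2) * (x powr (2 - \<alpha>) / (2 - \<alpha>)))) {0..x}"
    by (intro has_integral_add has_integral_mult_right)
  moreover have "a1 * t powr (- \<alpha>) + (2 * a2) * t powr (1 - \<alpha>) = (a1 + 2 * a2 * t) * t powr (- \<alpha>)"
    if "t \<in> {0..x}" for t
    using that powr_add[of t "- \<alpha>" 1] by (cases "t = 0") (auto simp: algebra_simps)
  ultimately show ?thesis
    by (subst has_integral_cong[where g = "\<lambda>t. a1 * t powr (- \<alpha>) + (2 * a2) * t powr (1 - \<alpha>)"]) auto
qed

text \<open>The case of a function that vanishes to third order at \<open>x\<close>, where the boundary terms at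
  \<open>x\<close> coming from its Taylor quadratic at $0$ and from the remainder cancel.\<close>

lemma scheme_flat_end:
  fixes U :: "nat \<Rightarrow> real \<Rightarrow> real"
  assumes x: "x > 0" and \<alpha>: "0 < \<alpha>" "\<alpha> < 1"
    and U: "\<And>j t. j \<le> 2 \<Longrightarrow> t \<in> {0..x} \<Longrightarrow> (U j has_real_derivative U (Suc j) t) (at t within {0..x})"
    and B: "\<And>t. t \<in> {0..x} \<Longrightarrow> \<bar>U 3 t\<bar> \<le> B"
    and flat: "U 0 x = 0" "U 1 x = 0" "U 2 x = 0"
  obtains J where "((\<lambda>t. U 1 t * t powr (- \<alpha>)) has_integral J) {0..x}"
    and "(\<lambda>n. (x / real n) powr (- \<alpha>) * (\<Sum>k=0..n. delta \<alpha> n k * U 0 (real k * (x / real n))) - J / \<alpha>)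
            \<in> O(\<lambda>n. (x / real n) powr (3 - \<alpha>))"
proof -
  (* r j is the j-th derivative of U 0 minus its Taylor quadratic at 0 *)
  define c0 c1 c2 where "c0 = U 0 0" "c1 = U 1 0" "c2 = U 2 0 / 2"
  define r where "r = (\<lambda>j t. U j t - (if j = 0 then c0 + c1 * t + c2 * t\<^sup>2 else if j = 1 then c1 + 2 * c2 * t
      else if j = (2::nat) then 2 * c2 else 0))"
  have r0: "r 0 t = U 0 t - (c0 + c1 * t + c2 * t\<^sup>2)" and r1: "r 1 t = U 1 t - (c1 + 2 * c2 * t)" for t
    by (simp_all add: r_def)
  have r_deriv: "(r j has_real_derivative r (Suc j) t) (at t within {0..x})" if "j \<le> 2" "t \<in> {0..x}" for j t
  proof -
    have "j = 0 \<or> j = 1 \<or> j = 2" using that(1) by linarith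
    then show ?thesis using U[OF that]
      by (auto simp: r_def intro!: derivative_eq_intros)
  qed
  have x0: "0 \<in> {0..x}" "x \<in> {0..x}" using x by auto
  have r_bound: "\<bar>r j t\<bar> \<le> B * t ^ (3 - j)" if "j \<le> 3" "t \<in> {0..x}" for j t
  proof -
    have "j = 0 \<or> j = 1 \<or> j = 2 \<or> j = 3" using that(1) by linarith
    then show ?thesis
      using taylor_quadratic[where U = U, OF U B x0(1) that(2)] B[OF that(2)] that(2)
      by (auto simp: r_def c0_c1_c2_def numeral_2_eq_2 numeral_3_eq_3)
  qed
  obtain I K where I: "((\<lambda>t. r 1 t * t powr (- \<alpha>)) has_integral (\<alpha> * I + r 0 x * x powr (- \<alpha>))) {0..x}"
    and K: "\<And>n h. n \<ge> 1 \<Longrightarrow> h = x / real n \<Longrightarrow>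
      \<bar>h * (\<Sum>k=1..<n. r 0 (real k * h) * (real k * h) powr (- 1 - \<alpha>))
        - (I - h / 2 * (r 0 x * x powr (- 1 - \<alpha>))
             + h\<^sup>2 / 12 * (r 1 x * x powr (- 1 - \<alpha>) - (1 + \<alpha>) * (r 0 x * x powr (- 2 - \<alpha>))))\<bar>
      \<le> K * h powr (3 - \<alpha>)"
  proof (rule singular_trapezoid[where r = r and C = B, OF x \<alpha>])
    show "(r j has_real_derivative r (Suc j) t) (at t within {0..x})" if "j \<le> 2" "t \<in> {0..x}" for j t
      using that by (rule r_deriv)
    show "\<bar>r j t\<bar> \<le> B * t ^ (3 - j)" if "j \<le> 3" "t \<in> {0..x}" for j t
      using that by (rule r_bound)
  qed (rule that)
  define J where "J = (\<alpha> * I + r 0 x * x powr (- \<alpha>))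
      + (c1 * x powr (1 - \<alpha>) / (1 - \<alpha>) + 2 * c2 * x powr (2 - \<alpha>) / (2 - \<alpha>))"
  have J: "((\<lambda>t. U 1 t * t powr (- \<alpha>)) has_integral J) {0..x}"
  proof -
    have "((\<lambda>t. r 1 t * t powr (- \<alpha>) + (c1 + 2 * c2 * t) * t powr (- \<alpha>)) has_integral J) {0..x}"
      unfolding J_def by (intro has_integral_add I has_integral_quadratic_powr x \<alpha>)
    then show ?thesis unfolding r1 distrib_right[symmetric] by simp
  qed

  define h where "h = (\<lambda>n. x / real n)"
  define g g' where "g = r 0 x * x powr (- 1 - \<alpha>)" "g' = r 1 x * x powr (- 1 - \<alpha>) - (1 + \<alpha>) * (r 0 x * x powr (- 2 - \<alpha>))"
  define E1 where "E1 = (\<lambda>n. h n * (\<Sum>k=1..<n. r 0 (real k * h n) * (real k * h n) powr (- 1 - \<alpha>))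
      - (I - h n / 2 * g + (h n)\<^sup>2 / 12 * g'))"
  define ES where "ES = (\<lambda>a n. h n powr (1 - a) * Szeta n a
      - (x powr (1 - a) / (1 - a) - h n / 2 * x powr (- a) - a / 12 * (h n)\<^sup>2 * x powr (- a - 1)))"
  define R where "R = (\<lambda>n. (- zeta_real \<alpha>) * (2 * r 0 (h n) - 1/2 * r 0 (2 * h n))
      - (1/2 * zeta_real (\<alpha> - 1)) * (r 0 (2 * h n) - 2 * r 0 (h n))
      + end_corr2 \<alpha> n * U 0 (x - 2 * h n) + end_corr1 \<alpha> n * U 0 (x - h n))"
  have main: "h n powr (- \<alpha>) * (\<Sum>k=0..n. delta \<alpha> n k * U 0 (real k * h n)) - J / \<alpha>
      = E1 n + c0 * ES (\<alpha> + 1) n + c1 * ES \<alpha> n + c2 * ES (\<alpha> - 1) n + h n powr (- \<alpha>) * R n" if n: "n \<ge> 6" for n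
  proof -
    define H where "H = h n"
    have H: "H > 0" "real n * H = x" using x n by (auto simp: H_def h_def)
    have ends: "real (n - 2) * H = x - 2 * H" "real (n - 1) * H = x - H"
      using H n by (simp_all add: of_nat_diff algebra_simps)
    have U0: "U 0 t = r 0 t + (c0 + c1 * t + c2 * t\<^sup>2)" for t by (simp add: r0)
    have rz: "r 0 0 = 0" by (simp add: r0 c0_c1_c2_def)
    define \<sigma> where "\<sigma> = (\<Sum>k=1..<n. real k powr (- 1 - \<alpha>) * r 0 (real k * H))"
    have sumU: "(\<Sum>k=1..<n. real k powr (- 1 - \<alpha>) * U 0 (real k * H)) = \<sigma>
        + (c0 * (Szeta n (\<alpha> + 1) + zeta_real (1 + \<alpha>)) + c1 * H * (Szeta n \<alpha> + zeta_real \<alpha>)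
            + c2 * H\<^sup>2 * (Szeta n (\<alpha> - 1) + zeta_real (\<alpha> - 1)))"
      unfolding \<sigma>_def sum_powr_quadratic[symmetric] sum.distrib[symmetric]
      by (intro sum.cong refl) (simp add: U0 algebra_simps power_mult_distrib)
    have "(\<Sum>k=0..n. delta \<alpha> n k * U 0 (real k * H)) = \<sigma>
        + c0 * Szeta n (\<alpha> + 1) + c1 * H * Szeta n \<alpha> + c2 * H\<^sup>2 * Szeta n (\<alpha> - 1) + R n"
    proof -
      have F: "(\<Sum>k=0..n. delta \<alpha> n k * U 0 (real k * H))
        = (\<Sum>k=1..<n. real k powr (- 1 - \<alpha>) * U 0 (real k * H))
         - zeta_real (1 + \<alpha>) * U 0 0 + zeta_real \<alpha> * (3/2 * U 0 0 - 2 * U 0 H + 1/2 * U 0 (2 * H))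
         - 1/2 * zeta_real (\<alpha> - 1) * (U 0 0 - 2 * U 0 H + U 0 (2 * H))
         + end_corr2 \<alpha> n * U 0 (x - 2 * H) + end_corr1 \<alpha> n * U 0 (x - H) + end_corr0 \<alpha> n * U 0 x"
        unfolding sum_delta[OF n] ends H(2) by simp
      have R: "R n = (- zeta_real \<alpha>) * (2 * r 0 H - 1/2 * r 0 (2 * H))
          - (1/2 * zeta_real (\<alpha> - 1)) * (r 0 (2 * H) - 2 * r 0 H)
          + end_corr2 \<alpha> n * U 0 (x - 2 * H) + end_corr1 \<alpha> n * U 0 (x - H)"
        by (simp add: R_def H_def)
      show ?thesis
        unfolding F R sumU flat
        unfolding U0[of 0] U0[of H] U0[of "2 * H"] rz
        by (simp add: field_simps power2_eq_square)
    qed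
    then have "H powr (- \<alpha>) * (\<Sum>k=0..n. delta \<alpha> n k * U 0 (real k * H))
        = H powr (- \<alpha>) * \<sigma> + c0 * (H powr (- \<alpha>) * Szeta n (\<alpha> + 1)) + c1 * (H powr (- \<alpha>) * H * Szeta n \<alpha>)
          + c2 * (H powr (- \<alpha>) * H\<^sup>2 * Szeta n (\<alpha> - 1)) + H powr (- \<alpha>) * R n"
      by (simp add: algebra_simps)
    also have "H powr (- \<alpha>) * \<sigma> = H * (\<Sum>k=1..<n. r 0 (real k * H) * (real k * H) powr (- 1 - \<alpha>))"
    proof -
      have "H powr (- \<alpha>) = H * H powr (- 1 - \<alpha>)" using H powr_add[of H "- 1 - \<alpha>" 1] by simp
      then show ?thesis using H
        unfolding \<sigma>_def by (simp add: sum_distrib_left powr_mult mult_ac)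
    qed
    also have "H powr (- \<alpha>) * H = H powr (1 - \<alpha>)" using H powr_add[of H "- \<alpha>" 1] by simp
    also have "H powr (- \<alpha>) * H\<^sup>2 = H powr (1 - (\<alpha> - 1))" using H powr_add[of H "- \<alpha>" 2] by simp
    also have "H powr (- \<alpha>) * Szeta n (\<alpha> + 1) = H powr (1 - (\<alpha> + 1)) * Szeta n (\<alpha> + 1)" by simp
    finally have 1: "H powr (- \<alpha>) * (\<Sum>k=0..n. delta \<alpha> n k * U 0 (real k * H))
        = (E1 n + (I - H / 2 * g + H\<^sup>2 / 12 * g'))
          + c0 * (ES (\<alpha> + 1) n + (x powr (- \<alpha>) / (- \<alpha>) - H / 2 * x powr (- 1 - \<alpha>) - (\<alpha> + 1) / 12 * H\<^sup>2 * x powr (- 2 - \<alpha>)))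
          + c1 * (ES \<alpha> n + (x powr (1 - \<alpha>) / (1 - \<alpha>) - H / 2 * x powr (- \<alpha>) - \<alpha> / 12 * H\<^sup>2 * x powr (- 1 - \<alpha>)))
          + c2 * (ES (\<alpha> - 1) n + (x powr (2 - \<alpha>) / (2 - \<alpha>) - H / 2 * x powr (1 - \<alpha>) - (\<alpha> - 1) / 12 * H\<^sup>2 * x powr (- \<alpha>)))
          + H powr (- \<alpha>) * R n"
    proof -
      have e: "1 - (\<alpha> + 1) = - \<alpha>" "- (\<alpha> + 1) = - 1 - \<alpha>" "- 1 - \<alpha> - 1 = - 2 - \<alpha>" "- \<alpha> - 1 = - 1 - \<alpha>"
        "1 - (\<alpha> - 1) = 2 - \<alpha>" "- (\<alpha> - 1) = 1 - \<alpha>" "1 - \<alpha> - 1 = - \<alpha>" by simp_all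
      assume "H powr (- \<alpha>) * (\<Sum>k=0..n. delta \<alpha> n k * U 0 (real k * H))
        = H * (\<Sum>k=1..<n. r 0 (real k * H) * (real k * H) powr (- 1 - \<alpha>))
          + c0 * (H powr (1 - (\<alpha> + 1)) * Szeta n (\<alpha> + 1)) + c1 * (H powr (1 - \<alpha>) * Szeta n \<alpha>)
          + c2 * (H powr (1 - (\<alpha> - 1)) * Szeta n (\<alpha> - 1)) + H powr (- \<alpha>) * R n"
      then show ?thesis
        unfolding E1_def ES_def H_def[symmetric] e by simp
    qed
    define X where "X = x powr (- 2 - \<alpha>)"
    have X: "x powr (- 1 - \<alpha>) = x * X" "x powr (- \<alpha>) = x\<^sup>2 * X" "x powr (1 - \<alpha>) = x ^ 3 * X" "x powr (2 - \<alpha>) = x ^ 4 * X"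
      using x powr_add[of x "- 2 - \<alpha>" 1] powr_add[of x "- 2 - \<alpha>" 2] powr_add[of x "- 2 - \<alpha>" 3]
        powr_add[of x "- 2 - \<alpha>" 4] by (simp_all add: X_def)
    have rx: "r 0 x = - (c0 + c1 * x + c2 * x\<^sup>2)" "r 1 x = - (c1 + 2 * c2 * x)"
      unfolding r0 r1 flat by simp_all
    have 2: "(I - H / 2 * g + H\<^sup>2 / 12 * g')
          + c0 * (x powr (- \<alpha>) / (- \<alpha>) - H / 2 * x powr (- 1 - \<alpha>) - (\<alpha> + 1) / 12 * H\<^sup>2 * x powr (- 2 - \<alpha>))
          + c1 * (x powr (1 - \<alpha>) / (1 - \<alpha>) - H / 2 * x powr (- \<alpha>) - \<alpha> / 12 * H\<^sup>2 * x powr (- 1 - \<alpha>))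
          + c2 * (x powr (2 - \<alpha>) / (2 - \<alpha>) - H / 2 * x powr (1 - \<alpha>) - (\<alpha> - 1) / 12 * H\<^sup>2 * x powr (- \<alpha>))
        = I + c0 * (x powr (- \<alpha>) / (- \<alpha>)) + c1 * (x powr (1 - \<alpha>) / (1 - \<alpha>)) + c2 * (x powr (2 - \<alpha>) / (2 - \<alpha>))"
    proof -
      have "- H / 2 * g + H\<^sup>2 / 12 * g'
          - c0 * (H / 2 * x powr (- 1 - \<alpha>) + (\<alpha> + 1) / 12 * H\<^sup>2 * X)
          - c1 * (H / 2 * x powr (- \<alpha>) + \<alpha> / 12 * H\<^sup>2 * x powr (- 1 - \<alpha>))
          - c2 * (H / 2 * x powr (1 - \<alpha>) + (\<alpha> - 1) / 12 * H\<^sup>2 * x powr (- \<alpha>)) = 0"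
        unfolding g_g'_def rx X X_def[symmetric] by (simp add: field_simps power2_eq_square power3_eq_cube)
      then show ?thesis unfolding X_def[symmetric] by (simp add: algebra_simps)
    qed
    have 3: "J / \<alpha> = I + c0 * (x powr (- \<alpha>) / (- \<alpha>)) + c1 * (x powr (1 - \<alpha>) / (1 - \<alpha>)) + c2 * (x powr (2 - \<alpha>) / (2 - \<alpha>))"
    proof -
      define D where "D = X / (\<alpha> * (1 - \<alpha>) * (2 - \<alpha>))"
      have XD: "X = \<alpha> * (1 - \<alpha>) * (2 - \<alpha>) * D" using \<alpha> by (simp add: D_def)
      have q: "x\<^sup>2 * X / (- \<alpha>) = - x\<^sup>2 * ((1 - \<alpha>) * (2 - \<alpha>) * D)" "x\<^sup>2 * X / \<alpha> = x\<^sup>2 * ((1 - \<alpha>) * (2 - \<alpha>) * D)"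
        "x ^ 3 * X / (1 - \<alpha>) = x ^ 3 * (\<alpha> * (2 - \<alpha>) * D)" "x ^ 4 * X / (2 - \<alpha>) = x ^ 4 * (\<alpha> * (1 - \<alpha>) * D)"
        using \<alpha> by (simp_all add: XD)
      have "J / \<alpha> = I + r 0 x * (x\<^sup>2 * X / \<alpha>) + c1 * (x ^ 3 * X / (1 - \<alpha>)) / \<alpha> + 2 * c2 * (x ^ 4 * X / (2 - \<alpha>)) / \<alpha>"
        using \<alpha> unfolding J_def X by (simp add: add_divide_distrib)
      also have "\<dots> = I - (c0 + c1 * x + c2 * x\<^sup>2) * (x\<^sup>2 * ((1 - \<alpha>) * (2 - \<alpha>) * D)) + c1 * (x ^ 3 * ((2 - \<alpha>) * D))
          + 2 * c2 * (x ^ 4 * ((1 - \<alpha>) * D))"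
        unfolding q rx mult_minus_left using \<alpha> by simp
      also have "\<dots> = I + c0 * (x\<^sup>2 * X / (- \<alpha>)) + c1 * (x ^ 3 * X / (1 - \<alpha>)) + c2 * (x ^ 4 * X / (2 - \<alpha>))"
        unfolding q by (simp add: algebra_simps power2_eq_square power3_eq_cube power4_eq_xxxx)
      finally show ?thesis unfolding X .
    qed
    have cancel: "(E + A) + c0 * (e0 + p0) + c1 * (e1 + p1) + c2 * (e2 + p2) + S - (A + c0 * p0 + c1 * p1 + c2 * p2)
        = E + c0 * e0 + c1 * e1 + c2 * e2 + S" for E A e0 p0 e1 p1 e2 p2 S :: real
      by (simp add: algebra_simps)
    show ?thesis
      unfolding H_def[symmetric] 1 3 2[symmetric] by (rule cancel)
  qed

  have hO: "(\<lambda>n. h n powr (- \<alpha>) * R n) \<in> O(\<lambda>n. (x / real n) powr (3 - \<alpha>))"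
  proof -
    (* the factor 8 = 2^3 accounts for the points at distance 2h from an end *)
    have bigo3: "(\<lambda>n. F n) \<in> O(\<lambda>n. h n ^ 3)" if "\<And>n. n \<ge> 6 \<Longrightarrow> \<bar>F n\<bar> \<le> 8 * B * h n ^ 3" for F
      by (rule bigoI[of _ "8 * B"])
        (use that x in \<open>auto simp: eventually_at_top_linorder h_def intro!: exI[of _ 6]\<close>)
    have B0: "B \<ge> 0" using B[OF x0(1)] by linarith
    have hn: "h n > 0" "2 * h n \<le> x" if "n \<ge> 6" for n
      using that x by (auto simp: h_def field_simps)
    have le8: "B * h n ^ 3 \<le> 8 * B * h n ^ 3" if "n \<ge> 6" for n
      using B0 hn(1)[OF that] by simp
    have flat_bound: "\<bar>U 0 t\<bar> \<le> B * (x - t) ^ 3" if "t \<in> {0..x}" for t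
      using taylor_quadratic(1)[where U = U, OF U B x0(2) that] flat that by simp
    have Oa: "(\<lambda>n. r 0 (h n)) \<in> O(\<lambda>n. h n ^ 3)"
    proof (rule bigo3)
      fix n :: nat assume n: "n \<ge> 6"
      show "\<bar>r 0 (h n)\<bar> \<le> 8 * B * h n ^ 3"
        using r_bound[of 0 "h n"] hn[OF n] le8[OF n] by auto
    qed
    have Ob: "(\<lambda>n. r 0 (2 * h n)) \<in> O(\<lambda>n. h n ^ 3)"
    proof (rule bigo3)
      fix n :: nat assume n: "n \<ge> 6"
      show "\<bar>r 0 (2 * h n)\<bar> \<le> 8 * B * h n ^ 3"
        using r_bound[of 0 "2 * h n"] hn[OF n] by (auto simp: power_mult_distrib)
    qed
    have Oc: "(\<lambda>n. U 0 (x - h n)) \<in> O(\<lambda>n. h n ^ 3)"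
    proof (rule bigo3)
      fix n :: nat assume n: "n \<ge> 6"
      show "\<bar>U 0 (x - h n)\<bar> \<le> 8 * B * h n ^ 3"
        using flat_bound[of "x - h n"] hn[OF n] le8[OF n] by auto
    qed
    have Od: "(\<lambda>n. U 0 (x - 2 * h n)) \<in> O(\<lambda>n. h n ^ 3)"
    proof (rule bigo3)
      fix n :: nat assume n: "n \<ge> 6"
      show "\<bar>U 0 (x - 2 * h n)\<bar> \<le> 8 * B * h n ^ 3"
        using flat_bound[of "x - 2 * h n"] hn[OF n] by (auto simp: power_mult_distrib)
    qed
    have "(\<lambda>n. end_corr2 \<alpha> n * U 0 (x - 2 * h n)) \<in> O(\<lambda>n. 1 * h n ^ 3)"
      "(\<lambda>n. end_corr1 \<alpha> n * U 0 (x - h n)) \<in> O(\<lambda>n. 1 * h n ^ 3)"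
      by (intro landau_o.big.mult end_corr_bounded \<alpha> Oc Od)+
    then have "R \<in> O(\<lambda>n. h n ^ 3)"
      unfolding R_def by (intro sum_in_bigo bigo_cmult Oa Ob) simp_all
    then have "(\<lambda>n. h n powr (- \<alpha>) * R n) \<in> O(\<lambda>n. h n powr (- \<alpha>) * h n ^ 3)"
      by (rule landau_o.big.mult_left)
    also have "(\<lambda>n. h n powr (- \<alpha>) * h n ^ 3) \<in> O(\<lambda>n. (x / real n) powr (3 - \<alpha>))"
      unfolding h_def using x by real_asymp
    finally show ?thesis .
  qed
  have E1: "E1 \<in> O(\<lambda>n. (x / real n) powr (3 - \<alpha>))"
    by (rule bigoI[of _ K])
      (use K in \<open>auto simp: eventually_at_top_linorder E1_def h_def g_g'_def intro!: exI[of _ 1]\<close>)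
  have ES: "ES a \<in> O(\<lambda>n. (x / real n) powr (3 - \<alpha>))" if "a > -2" "a \<noteq> 1" "a \<noteq> 0" "a \<noteq> -1" for a
    unfolding ES_def h_def by (rule Szeta_scaled[OF x \<alpha>(1) that])
  have "(\<lambda>n. E1 n + c0 * ES (\<alpha> + 1) n + c1 * ES \<alpha> n + c2 * ES (\<alpha> - 1) n + h n powr (- \<alpha>) * R n)
      \<in> O(\<lambda>n. (x / real n) powr (3 - \<alpha>))"
    by (intro sum_in_bigo bigo_cmult E1 ES hO) (use \<alpha> in auto)
  then have "(\<lambda>n. h n powr (- \<alpha>) * (\<Sum>k=0..n. delta \<alpha> n k * U 0 (real k * h n)) - J / \<alpha>)
      \<in> O(\<lambda>n. (x / real n) powr (3 - \<alpha>))"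
    by (rule landau_o.big.in_cong[THEN iffD2, rotated])
      (use main in \<open>auto simp: eventually_at_top_linorder intro!: exI[of _ 6]\<close>)
  then show thesis by (intro that[OF J]) (simp add: h_def)
qed

theorem mainTheorem4:
  fixes \<alpha> x :: real and y :: "real \<Rightarrow> real"
  assumes "0 < \<alpha>" and "\<alpha> < 1" and "0 < x" and "smooth_on {0..x} y"
  shows "(\<lambda>n. let h = x / real n in
            1 / (Gamma (- \<alpha>) * h powr \<alpha>) * (\<Sum>k=0..n. delta \<alpha> n k * y (real (n - k) * h))
            - caputo \<alpha> y x) \<in> O(\<lambda>n. (x / real n) powr (3 - \<alpha>))"
proof -
  note \<alpha> = assms(1,2) and x = assms(3)
  obtain D where D0: "\<And>t. t \<in> {0..x} \<Longrightarrow> D 0 t = y t"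
    and D: "\<And>k t. t \<in> {0..x} \<Longrightarrow> (D k has_real_derivative D (Suc k) t) (at t within {0..x})"
    using assms(4) unfolding smooth_on_def by blast
  have x0: "0 \<in> {0..x}" "x \<in> {0..x}" using x by auto
  define Z where "Z = (\<lambda>k t. (-1) ^ k * D k (x - t))"
  have Z: "(Z k has_real_derivative Z (Suc k) t) (at t within {0..x})" if t: "t \<in> {0..x}" for k t
  proof -
    have im: "(\<lambda>t. x - t) ` {0..x} = {0..x}" by (auto simp: image_iff intro!: bexI[of _ "x - _"])
    have "(D k has_real_derivative D (Suc k) (x - t)) (at (x - t) within (\<lambda>t. x - t) ` {0..x})"
      unfolding im using t by (intro D) auto
    moreover have "((\<lambda>t. x - t) has_real_derivative (- 1)) (at t within {0..x})"
      by (auto intro!: derivative_eq_intros)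
    ultimately have "((\<lambda>t. D k (x - t)) has_real_derivative D (Suc k) (x - t) * (- 1)) (at t within {0..x})"
      by (rule DERIV_image_chain[unfolded o_def])
    then show ?thesis unfolding Z_def
      by (rule DERIV_cmult[THEN DERIV_cong]) simp
  qed
  (* the Taylor quadratic of Z 0 at x, in powers of t *)
  define a0 a1 a2 where "a0 = Z 0 x - Z 1 x * x + Z 2 x / 2 * x\<^sup>2" "a1 = Z 1 x - Z 2 x * x" "a2 = Z 2 x / 2"
  define U where "U = (\<lambda>j t. Z j t - (if j = 0 then a0 + a1 * t + a2 * t\<^sup>2 else if j = 1 then a1 + 2 * a2 * t
      else if j = (2::nat) then 2 * a2 else 0))"
  have U: "(U j has_real_derivative U (Suc j) t) (at t within {0..x})" if "j \<le> 2" "t \<in> {0..x}" for j t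
  proof -
    have "j = 0 \<or> j = 1 \<or> j = 2" using that(1) by linarith
    then show ?thesis using Z[OF that(2), of j]
      by (auto simp: U_def intro!: derivative_eq_intros)
  qed
  have flat: "U 0 x = 0" "U 1 x = 0" "U 2 x = 0"
    by (simp_all add: U_def a0_a1_a2_def algebra_simps power2_eq_square)
  have "continuous_on {0..x} (Z 3)" by (rule DERIV_continuous_on[OF Z])
  then have "bounded (Z 3 ` {0..x})"
    by (intro compact_imp_bounded compact_continuous_image) auto
  then obtain B where "\<And>t. t \<in> {0..x} \<Longrightarrow> \<bar>Z 3 t\<bar> \<le> B"
    unfolding bounded_iff by (metis imageI real_norm_def)
  then have B: "\<And>t. t \<in> {0..x} \<Longrightarrow> \<bar>U 3 t\<bar> \<le> B" by (simp add: U_def)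
  obtain J where J: "((\<lambda>t. U 1 t * t powr (- \<alpha>)) has_integral J) {0..x}"
    and scheme: "(\<lambda>n. (x / real n) powr (- \<alpha>) * (\<Sum>k=0..n. delta \<alpha> n k * U 0 (real k * (x / real n))) - J / \<alpha>)
            \<in> O(\<lambda>n. (x / real n) powr (3 - \<alpha>))"
  proof (rule scheme_flat_end[where U = U and B = B, OF x \<alpha>])
    show "(U j has_real_derivative U (Suc j) t) (at t within {0..x})" if "j \<le> 2" "t \<in> {0..x}" for j t
      using that by (rule U)
    show "\<bar>U 3 t\<bar> \<le> B" if "t \<in> {0..x}" for t
      using that by (rule B)
  qed (rule flat that)+
  define Q where "Q = a1 * x powr (1 - \<alpha>) / (1 - \<alpha>) + 2 * a2 * x powr (2 - \<alpha>) / (2 - \<alpha>)"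

  have caputo: "caputo \<alpha> y x = - (J + Q) / Gamma (1 - \<alpha>)"
  proof -
    have "((\<lambda>t. U 1 t * t powr (- \<alpha>) + (a1 + 2 * a2 * t) * t powr (- \<alpha>)) has_integral (J + Q)) {0..x}"
      unfolding Q_def by (intro has_integral_add J has_integral_quadratic_powr x \<alpha>)
    then have "((\<lambda>t. Z 1 t * t powr (- \<alpha>)) has_integral (J + Q)) (cbox 0 x)"
      by (simp add: U_def distrib_right[symmetric])
    then have "((\<lambda>t. Z 1 (x - t) * (x - t) powr (- \<alpha>)) has_integral (J + Q)) ((\<lambda>t. x - t) ` {0..x})"
      using has_integral_affinity[of "\<lambda>t. Z 1 t * t powr (- \<alpha>)" "J + Q" 0 x "- 1" x] by simp
    moreover have "(\<lambda>t. x - t) ` {0..x} = {0..x}" by (auto simp: image_iff intro!: bexI[of _ "x - _"])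
    ultimately have "((\<lambda>t. Z 1 (x - t) * (x - t) powr (- \<alpha>)) has_integral (J + Q)) {0..x}" by simp
    then have "((\<lambda>t. - (Z 1 (x - t) * (x - t) powr (- \<alpha>))) has_integral - (J + Q)) {0..x}"
      by (rule has_integral_neg)
    moreover have "vector_derivative y (at t within {0..x}) / (x - t) powr \<alpha> = - (Z 1 (x - t) * (x - t) powr (- \<alpha>))"
      if t: "t \<in> {0..x}" for t
    proof -
      have "(y has_real_derivative D 1 t) (at t within {0..x})"
        using D[OF t, of 0] unfolding One_nat_def by (rule has_field_derivative_transform_within[OF _ zero_less_one t]) (simp_all add: D0)
      then have "vector_derivative y (at t within {0..x}) = D 1 t"
        by (intro vector_derivative_within_closed_interval x t)
          (simp add: has_real_derivative_iff_has_vector_derivative)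
      then show ?thesis by (simp add: Z_def powr_minus field_simps)
    qed
    ultimately have "((\<lambda>t. vector_derivative y (at t within {0..x}) / (x - t) powr \<alpha>) has_integral - (J + Q)) {0..x}"
      by (subst has_integral_cong) auto
    then show ?thesis unfolding caputo_def by (simp add: integral_unique)
  qed
  have Gam: "Gamma (1 - \<alpha>) = - \<alpha> * Gamma (- \<alpha>)"
  proof -
    have "- \<alpha> \<notin> \<int>\<^sub>\<le>\<^sub>0"
    proof
      assume "- \<alpha> \<in> \<int>\<^sub>\<le>\<^sub>0"
      then have "\<alpha> \<in> \<int>" using Ints_minus nonpos_Ints_Int by fastforce
      with \<alpha> show False by (auto elim!: Ints_cases)
    qed
    then show ?thesis using Gamma_plus1[of "- \<alpha>"] by (simp add: add.commute)
  qed
  have eq: "1 / (Gamma (- \<alpha>) * (x / real n) powr \<alpha>)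
         * (\<Sum>k=0..n. delta \<alpha> n k * y (real (n - k) * (x / real n))) - caputo \<alpha> y x
      = 1 / Gamma (- \<alpha>) * ((x / real n) powr (- \<alpha>) * (\<Sum>k=0..n. delta \<alpha> n k * U 0 (real k * (x / real n))) - J / \<alpha>)"
    if n: "n \<ge> 6" for n
  proof -
    define h where "h = x / real n"
    have h: "h > 0" "real n * h = x" using x n by (auto simp: h_def)
    have "(\<Sum>k=0..n. delta \<alpha> n k * y (real (n - k) * h))
        = (\<Sum>k=0..n. delta \<alpha> n k * U 0 (real k * h))
          + (\<Sum>k=0..n. delta \<alpha> n k * (a0 + (a1 * h) * real k + (a2 * h\<^sup>2) * (real k)\<^sup>2))"
      unfolding sum.distrib[symmetric]
    proof (intro sum.cong refl)
      fix k assume "k \<in> {0..n}"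
      then have k: "real (n - k) * h = x - real k * h" "real (n - k) * h \<in> {0..x}"
        using h mult_right_mono[of "real (n - k)" "real n" h] by (auto simp: of_nat_diff algebra_simps)
      have "y (real (n - k) * h) = Z 0 (real k * h)"
        using D0[OF k(2)] k(1) by (simp add: Z_def)
      then show "delta \<alpha> n k * y (real (n - k) * h) = delta \<alpha> n k * U 0 (real k * h)
          + delta \<alpha> n k * (a0 + (a1 * h) * real k + (a2 * h\<^sup>2) * (real k)\<^sup>2)"
        by (simp add: U_def algebra_simps power_mult_distrib)
    qed
    also have "(\<Sum>k=0..n. delta \<alpha> n k * (a0 + (a1 * h) * real k + (a2 * h\<^sup>2) * (real k)\<^sup>2)) = h powr \<alpha> * (Q / \<alpha>)"
    proof -
      have N: "h powr \<alpha> * x powr (1 - \<alpha>) = h * real n powr (1 - \<alpha>)"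
        "h powr \<alpha> * x powr (2 - \<alpha>) = h\<^sup>2 * real n powr (2 - \<alpha>)"
        unfolding h(2)[symmetric] using h(1) powr_add[of h \<alpha> "1 - \<alpha>"] powr_add[of h \<alpha> "2 - \<alpha>"]
        by (simp_all add: powr_mult)
      have "h powr \<alpha> * (Q / \<alpha>) = a1 * (h powr \<alpha> * x powr (1 - \<alpha>)) / (\<alpha> * (1 - \<alpha>))
          + 2 * a2 * (h powr \<alpha> * x powr (2 - \<alpha>)) / (\<alpha> * (2 - \<alpha>))"
        unfolding Q_def by (simp add: algebra_simps add_divide_distrib)
      then show ?thesis unfolding N sum_delta_quadratic[OF n \<alpha>] by (simp add: mult_ac)
    qed
    finally have S: "(\<Sum>k=0..n. delta \<alpha> n k * y (real (n - k) * h))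
        = (\<Sum>k=0..n. delta \<alpha> n k * U 0 (real k * h)) + h powr \<alpha> * (Q / \<alpha>)" .
    have "h powr (- \<alpha>) * h powr \<alpha> = 1" using h powr_add[of h "- \<alpha>" \<alpha>] by simp
    then have "1 / (Gamma (- \<alpha>) * h powr \<alpha>) * (\<Sum>k=0..n. delta \<alpha> n k * y (real (n - k) * h))
        = 1 / Gamma (- \<alpha>) * (h powr (- \<alpha>) * (\<Sum>k=0..n. delta \<alpha> n k * U 0 (real k * h)) + Q / \<alpha>)"
      unfolding S using h by (simp add: powr_minus distrib_left field_simps)
    moreover have "caputo \<alpha> y x = 1 / Gamma (- \<alpha>) * ((J + Q) / \<alpha>)"
      unfolding caputo Gam mult_minus_left minus_divide_divide by (simp add: mult.commute)
    ultimately show ?thesis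
      unfolding h_def[symmetric] by (simp add: algebra_simps add_divide_distrib)
  qed
  have "(\<lambda>n. 1 / Gamma (- \<alpha>) * ((x / real n) powr (- \<alpha>)
         * (\<Sum>k=0..n. delta \<alpha> n k * U 0 (real k * (x / real n))) - J / \<alpha>)) \<in> O(\<lambda>n. (x / real n) powr (3 - \<alpha>))"
    by (rule bigo_cmult[OF scheme])
  then show ?thesis
    unfolding Let_def
    by (rule landau_o.big.in_cong[THEN iffD2, rotated])
      (use eq in \<open>auto simp: eventually_at_top_linorder intro!: exI[of _ 6]\<close>)
qed

end
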